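(* Let $d\ge1$, $n\ge1$ be integers and let $A$ be a real $n\times d$ matrix with rows $\vec\alpha_1,\dots,\vec\alpha_n$ which is badly approximable with approximation constant $C_A>0$. Let $Q=\frac{1}{2n}\sum_{i=1}^n(\delta_{\vec\alpha_i}+\delta_{-\vec\alpha_i})$ be the probability measure on $\mathbb{T}^d=\mathbb{R}^d/\mathbb{Z}^d$ generating the random walk (each row $\vec\alpha_i$ taken mod 1). Then for every positive integer $k$, $$D(Q^{*k})\ \le\ \left(\frac{3}{2}\right)^d\, 20\,\left(\frac{n}{C_A\sqrt{2}}\right)^{n/d} k^{-n/2d}.$$
   Context: For $x\in\mathbb{R}^m$, $\|x\|_\infty$ is the supremum norm and $\{x\}_\infty$ is the supremum-norm distance from $x$ to the nearest point of $\mathbb{Z}^m$. An $n\times d$ real matrix $A$ is called badly approximable if there exists a constant $C_A>0$ (called an approximation constant of $A$) such that $\{A\mathbf{h}\}_\infty > C_A/\|\mathbf{h}\|_\infty^{d/n}$ for all nonzero $\mathbf{h}\in\mathbb{Z}^d$. $Q^{*k}$ is the $k$-fold convolution of $Q$ on the additive group $\mathbb{T}^d$, i.e. the distribution after $k$ steps of the random walk started at $\vec 0$ that at each step picks a row $\vec\alpha_i$ uniformly at random and adds or subtracts it (each with probability $1/2$) mod 1. Let $U$ be Haar (uniform) measure on $\mathbb{T}^d$. A box is a set $[a_1,b_1)\times\cdots\times[a_d,b_d)\subseteq\mathbb{T}^d$ with sides parallel to the axes, and the discrepancy of a probability measure $P$ is $D(P)=\sup_{B\text{ box}}|P(B)-U(B)|$.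 *)

theory Defs
  imports "HOL-Analysis.Analysis" "HOL-Probability.Probability"
begin

text \<open>Points of the torus T^d are represented by their representatives in [0,1)^d.\<close>

definition tmod :: "real^'d \<Rightarrow> real^'d" where
  "tmod x = (\<chi> i. frac (x $ i))"

definition sup_norm :: "real^'m \<Rightarrow> real" where
  "sup_norm x = Max (range (\<lambda>i. \<bar>x $ i\<bar>))"

definition dist_Zm :: "real^'m \<Rightarrow> real" where
  "dist_Zm x = Max (range (\<lambda>i. \<bar>x $ i - of_int (round (x $ i))\<bar>))"

definition int_vec :: "real^'d \<Rightarrow> bool" where
  "int_vec h \<longleftrightarrow> (\<forall>i. h $ i \<in> \<int>)"

definition badly_approximable_with :: "real^'d^'n \<Rightarrow> real \<Rightarrow> bool" where
  "badly_approximable_with A C \<longleftrightarrow> C > 0 \<and>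
     (\<forall>h. int_vec h \<and> h \<noteq> 0 \<longrightarrow>
        dist_Zm (A *v h) > C / (sup_norm h) powr (real CARD('d) / real CARD('n)))"

definition step_pmf :: "real^'d^'n \<Rightarrow> (real^'d) pmf" where
  "step_pmf A = map_pmf (\<lambda>(i, s). tmod (if s then A $ i else - (A $ i))) (pmf_of_set UNIV)"

definition torus_conv :: "(real^'d) pmf \<Rightarrow> (real^'d) pmf \<Rightarrow> (real^'d) pmf" where
  "torus_conv P R = map_pmf (\<lambda>(x, y). tmod (x + y)) (pair_pmf P R)"

fun conv_power :: "(real^'d) pmf \<Rightarrow> nat \<Rightarrow> (real^'d) pmf" where
  "conv_power P 0 = return_pmf 0"
| "conv_power P (Suc k) = torus_conv (conv_power P k) P"

definition torus_box :: "real^'d \<Rightarrow> real^'d \<Rightarrow> (real^'d) set" where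
  "torus_box a b = {x. \<forall>i. a $ i \<le> x $ i \<and> x $ i < b $ i}"

definition is_box_params :: "real^'d \<Rightarrow> real^'d \<Rightarrow> bool" where
  "is_box_params a b \<longleftrightarrow> (\<forall>i. 0 \<le> a $ i \<and> a $ i \<le> b $ i \<and> b $ i \<le> 1)"

definition haar_box :: "real^'d \<Rightarrow> real^'d \<Rightarrow> real" where
  "haar_box a b = (\<Prod>i\<in>UNIV. b $ i - a $ i)"

definition discrepancy :: "(real^'d) pmf \<Rightarrow> real" where
  "discrepancy P = (SUP ab \<in> {(a, b). is_box_params a b}.
      \<bar>measure_pmf.prob P (torus_box (fst ab) (snd ab)) - haar_box (fst ab) (snd ab)\<bar>)"

end

theory Submission
  imports Defs
begin

text \<open>
  Let \<open>n\<close>, \<open>d\<close> be the dimensions of the matrix and \<open>Y = (C sqrt (2 k) / n) ^ (n / d)\<close>, so that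
  the claim reads \<open>D \<le> 20 (3/2)^d / Y\<close>.

  The indicator of each side of a box is smoothed by a nonnegative trigonometric polynomial
  \<open>K\<close> of degree about \<open>Y / 4\<close> (the Fejer-Korovkin kernel), one coordinate at a time.
  An Esseen-type argument, applied at a box of extremal discrepancy, shows that each such step
  changes a discrepancy bound \<open>b\<close> to \<open>5/4 (b + 2 \<epsilon>)\<close> with \<open>\<epsilon>\<close> of order \<open>1 / Y\<close>; that \<open>K\<close> has
  little mass outside \<open>[-\<epsilon>, \<epsilon>]\<close> follows from its first Fourier coefficient by Chebyshev's
  inequality.

  Once all coordinates are smoothed, the discrepancy is a sum over the frequencies \<open>h \<noteq> 0\<close> in a
  cube, each weighted by at most \<open>1 / (\<pi> |h|)\<close>. The Fourier coefficient of the walk is bounded by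
  a Gaussian in the distances of \<open>2 A h\<close> to the integers. Half of the Gaussian absorbs the weight
  through the lower bound on the distances; the other half is summed by packing, because bad
  approximability keeps the points \<open>2 A h\<close> apart.
\<close>

section \<open>Smoothing kernels\<close>

lemma sum_int_support_shift:
  fixes f :: "int \<Rightarrow> 'a::comm_monoid_add"
  assumes "\<And>i. f i \<noteq> 0 \<Longrightarrow> i \<in> B" and "\<And>i. f i \<noteq> 0 \<Longrightarrow> i - j \<in> A" and "finite A" and "finite B"
  shows "(\<Sum>h\<in>A. f (j + h)) = (\<Sum>i\<in>B. f i)"
proof -
  have "(\<Sum>h\<in>A. f (j + h)) = (\<Sum>h\<in>{h\<in>A. f (j + h) \<noteq> 0}. f (j + h))"
    using assms by (intro sum.mono_neutral_right) auto
  also have "\<dots> = (\<Sum>i\<in>{i\<in>B. f i \<noteq> 0}. f i)"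
    by (rule sum.reindex_bij_witness[where i="\<lambda>i. i - j" and j="\<lambda>h. j + h"]) (use assms in auto)
  also have "\<dots> = (\<Sum>i\<in>B. f i)"
    using assms by (intro sum.mono_neutral_left) auto
  finally show ?thesis .
qed

text \<open>The coefficients \<open>R\<close> form the top eigenvector of the path graph, which
  maximises \<open>\<kappa> 1\<close> among normalised autocorrelations.\<close>

lemma fejer_korovkin_kernel:
  fixes L :: nat
  obtains \<kappa> :: "int \<Rightarrow> real" where
    "\<kappa> 0 = 1" "\<And>h. \<kappa> (- h) = \<kappa> h" "\<And>h. \<bar>\<kappa> h\<bar> \<le> 1"
    "\<kappa> 1 = cos (pi / (real L + 2))"
    "\<And>y. 0 \<le> (\<Sum>h\<in>{- int L..int L}. \<kappa> h * cos (2 * pi * of_int h * y))"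
proof -
  define \<theta> where "\<theta> = pi / (real L + 2)"
  define R :: "int \<Rightarrow> real" where "R j = (if 0 \<le> j \<and> j \<le> int L then sin ((of_int j + 1) * \<theta>) else 0)" for j
  define I where "I = {0..int L}"
  define c where "c = (\<Sum>j\<in>I. R j ^ 2)"
  define \<kappa> where "\<kappa> h = (\<Sum>j\<in>I. R j * R (j + h)) / c" for h
  have fin: "finite I" by (simp add: I_def)
  have supp: "R j \<noteq> 0 \<Longrightarrow> j \<in> I" for j by (auto simp: R_def I_def split: if_splits)
  have "0 < \<theta>" "\<theta> < pi"
    using pi_gt_zero by (auto simp: \<theta>_def field_simps intro!: add_pos_nonneg)
  then have "0 < R 0" by (simp add: R_def sin_gt_zero)
  moreover have "R 0 ^ 2 \<le> c"
    unfolding c_def using fin by (intro member_le_sum) (auto simp: I_def)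
  ultimately have c: "0 < c" by (metis less_le_trans zero_less_power)
  have shift_le: "(\<Sum>j\<in>I. R (j + h) ^ 2) \<le> c" for h
  proof -
    have "(\<Sum>j\<in>I. R (j + h) ^ 2) = (\<Sum>i\<in>(\<lambda>j. j + h) ` I. R i ^ 2)"
      by (subst sum.reindex) (auto simp: inj_on_def)
    also have "\<dots> = (\<Sum>i\<in>(\<lambda>j. j + h) ` I \<inter> I. R i ^ 2)"
      using fin supp by (intro sum.mono_neutral_right) auto
    also have "\<dots> \<le> c"
      unfolding c_def using fin by (intro sum_mono2) auto
    finally show ?thesis .
  qed
  have even: "(\<Sum>j\<in>I. R j * R (j + - h)) = (\<Sum>j\<in>I. R j * R (j + h))" for h
  proof -
    have "(\<Sum>j\<in>I. R j * R (j + - h)) = (\<Sum>j\<in>{j\<in>I. j - h \<in> I}. R j * R (j + - h))"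
      using fin supp by (intro sum.mono_neutral_right) auto
    also have "\<dots> = (\<Sum>j\<in>{j\<in>I. j + h \<in> I}. R j * R (j + h))"
      by (rule sum.reindex_bij_witness[where i="\<lambda>i. i + h" and j="\<lambda>i. i - h"]) auto
    also have "\<dots> = (\<Sum>j\<in>I. R j * R (j + h))"
      using fin supp by (intro sum.mono_neutral_left) auto
    finally show ?thesis .
  qed
  show ?thesis
  proof
    show "\<kappa> 0 = 1" using c by (simp add: \<kappa>_def c_def power2_eq_square)
    show "\<kappa> (- h) = \<kappa> h" for h unfolding \<kappa>_def using even by simp
    show "\<bar>\<kappa> h\<bar> \<le> 1" for h
    proof -
      have "\<bar>\<Sum>j\<in>I. R j * R (j + h)\<bar> \<le> (\<Sum>j\<in>I. \<bar>R j * R (j + h)\<bar>)" by (rule sum_abs)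
      also have "\<dots> \<le> (\<Sum>j\<in>I. (R j ^ 2 + R (j + h) ^ 2) / 2)"
      proof (rule sum_mono)
        fix j
        show "\<bar>R j * R (j + h)\<bar> \<le> (R j ^ 2 + R (j + h) ^ 2) / 2"
          using sum_squares_bound[of "\<bar>R j\<bar>" "\<bar>R (j + h)\<bar>"] by (simp add: abs_mult)
      qed
      also have "\<dots> = (c + (\<Sum>j\<in>I. R (j + h) ^ 2)) / 2"
        by (simp add: c_def sum.distrib flip: sum_divide_distrib)
      also have "\<dots> \<le> c" using shift_le[of h] by simp
      finally show ?thesis using c by (simp add: \<kappa>_def)
    qed
    have "2 * (\<Sum>j\<in>I. R j * R (j + 1)) = (\<Sum>j\<in>I. R j * R (j + 1)) + (\<Sum>j\<in>I. R j * R (j + - 1))"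
      using even[of 1] by simp
    also have "\<dots> = (\<Sum>j\<in>I. R j * (R (j + 1) + R (j - 1)))"
      by (simp add: sum.distrib distrib_left)
    also have "\<dots> = (\<Sum>j\<in>I. 2 * cos \<theta> * R j ^ 2)"
    proof (rule sum.cong)
      fix j assume j: "j \<in> I"
      \<comment> \<open>The cut-off of \<open>R\<close> is invisible to the eigenvalue equation: the
        sine formula already vanishes at both neighbours of the support, its argument being 0 on the
        left and (L + 2) \<theta> = pi on the right.\<close>
      have "R (j + 1) = sin ((of_int j + 2) * \<theta>)"
      proof (cases "j = int L")
        case True
        have "(real L + 2) * \<theta> = pi" by (simp add: \<theta>_def)
        then show ?thesis using True by (simp add: R_def)
      next
        case False
        then show ?thesis using j by (simp add: R_def I_def add.assoc)
      qed
      moreover have "R (j - 1) = sin (of_int j * \<theta>)"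
        using j by (cases "j = 0") (auto simp: R_def I_def)
      ultimately have "R (j + 1) + R (j - 1) = 2 * cos \<theta> * sin ((of_int j + 1) * \<theta>)"
        using sin_add[of "(of_int j + 1) * \<theta>" \<theta>] sin_diff[of "(of_int j + 1) * \<theta>" \<theta>]
        by (simp add: algebra_simps)
      also have "sin ((of_int j + 1) * \<theta>) = R j" using j by (simp add: R_def I_def)
      finally show "R j * (R (j + 1) + R (j - 1)) = 2 * cos \<theta> * R j ^ 2"
        by (simp add: power2_eq_square)
    qed simp
    also have "\<dots> = 2 * (cos \<theta> * c)" by (simp add: c_def sum_distrib_left mult.assoc)
    finally show "\<kappa> 1 = cos (pi / (real L + 2))"
      using c by (simp add: \<kappa>_def flip: \<theta>_def)
    show "0 \<le> (\<Sum>h\<in>{- int L..int L}. \<kappa> h * cos (2 * pi * of_int h * y))" for y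
    proof -
      let ?C = "\<lambda>i::int. cos (2 * pi * of_int i * y)" and ?S = "\<lambda>i::int. sin (2 * pi * of_int i * y)"
      have c\<kappa>: "c * (\<kappa> h * x) = (\<Sum>j\<in>I. R j * R (j + h) * x)" for h x
        using c by (simp add: \<kappa>_def sum_distrib_right)
      \<comment> \<open>Autocorrelation coefficients make the kernel a square: multiplied by
        \<open>c\<close> it is the squared modulus of the exponential sum with coefficients
        \<open>R j\<close>, written below as a sum of two real squares.\<close>
      have "c * (\<Sum>h\<in>{- int L..int L}. \<kappa> h * ?C h)
          = (\<Sum>h\<in>{- int L..int L}. \<Sum>j\<in>I. R j * R (j + h) * ?C h)"
        by (simp only: sum_distrib_left[of c] c\<kappa>)
      also have "\<dots> = (\<Sum>j\<in>I. \<Sum>h\<in>{- int L..int L}. R j * R (j + h) * ?C h)"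
        by (rule sum.swap)
      also have "\<dots> = (\<Sum>j\<in>I. \<Sum>i\<in>I. R j * R i * ?C (i - j))"
      proof (rule sum.cong)
        fix j assume j: "j \<in> I"
        have "(\<Sum>h\<in>{- int L..int L}. (\<lambda>i. R j * R i * ?C (i - j)) (j + h))
            = (\<Sum>i\<in>I. R j * R i * ?C (i - j))"
        proof (rule sum_int_support_shift)
          fix i assume "R j * R i * ?C (i - j) \<noteq> 0"
          then show i: "i \<in> I" using supp by simp
          show "i - j \<in> {- int L..int L}" using i j by (simp add: I_def)
        qed (use fin in simp_all)
        then show "(\<Sum>h\<in>{- int L..int L}. R j * R (j + h) * ?C h) = (\<Sum>i\<in>I. R j * R i * ?C (i - j))"
          by simp
      qed simp
      also have "\<dots> = (\<Sum>j\<in>I. \<Sum>i\<in>I. (R j * ?C j) * (R i * ?C i) + (R j * ?S j) * (R i * ?S i))"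
        by (intro sum.cong refl) (simp add: cos_diff left_diff_distrib right_diff_distrib algebra_simps)
      also have "\<dots> = (\<Sum>j\<in>I. R j * ?C j)\<^sup>2 + (\<Sum>j\<in>I. R j * ?S j)\<^sup>2"
        by (simp add: power2_eq_square sum_product sum.distrib)
      finally have "0 \<le> c * (\<Sum>h\<in>{- int L..int L}. \<kappa> h * ?C h)" by simp
      then show ?thesis using c by (simp add: zero_le_mult_iff)
    qed
  qed
qed

text \<open>Since \<Phi> descends with slope at most 1, an increment over a pair survives small
  shifts up to 2 \<epsilon>, once the pair has been widened (positive increment) or narrowed
  (negative one) by \<epsilon> at each end. With M the supremum of the increments, averaging against
  K gives M <= b + 2 \<epsilon> + 2 \<tau> M, which is solved for M. As g dominates the indicator of
  the tail, \<tau> bounds the tail mass.\<close>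

lemma esseen_smoothing:
  fixes \<Phi> \<Psi> K g :: "real \<Rightarrow> real" and \<epsilon> \<tau> b c :: real
  defines "I \<equiv> {-1/2..1/2}"
  assumes K0: "\<And>y. 0 \<le> K y" and K1: "(K has_integral 1) I"
    and chi0: "\<And>y. 0 \<le> g y" and chi1: "\<And>y. y \<in> I \<Longrightarrow> \<epsilon> < \<bar>y\<bar> \<Longrightarrow> 1 \<le> g y"
    and tail: "((\<lambda>y. K y * g y) has_integral \<tau>) I"
    and low: "\<And>s t. s \<le> t \<Longrightarrow> \<Phi> s - (t - s) \<le> \<Phi> t"
    and per: "\<And>s. \<Phi> (s + 1) = \<Phi> s + c"
    and avg: "\<And>v. ((\<lambda>y. K y * \<Phi> (v + y)) has_integral \<Psi> v) I"
    and bound: "\<And>u v. u \<le> v \<Longrightarrow> v \<le> u + 1 \<Longrightarrow> \<bar>\<Psi> v - \<Psi> u\<bar> \<le> b"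
    and eps: "0 < \<epsilon>" and tau: "2 * \<tau> < 1"
    and uv: "u \<le> v" "v \<le> u + 1"
  shows "\<bar>\<Phi> v - \<Phi> u\<bar> \<le> (b + 2 * \<epsilon>) / (1 - 2 * \<tau>)"
proof -
  have K1': "integral I K = 1" and b0: "0 \<le> b"
    using K1 bound[of 0 0] by (auto simp: integral_unique)
  have tau0: "0 \<le> \<tau>"
    using tail by (rule has_integral_nonneg) (simp add: K0 chi0)
  have perPsi: "\<Psi> (s + 1) = \<Psi> s + c" for s
  proof -
    have "((\<lambda>y. K y * \<Phi> (s + y) + K y * c) has_integral (\<Psi> s + 1 * c)) I"
      by (intro has_integral_add avg has_integral_mult_left K1)
    moreover have "(\<lambda>y. K y * \<Phi> (s + y) + K y * c) = (\<lambda>y. K y * \<Phi> (s + 1 + y))"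
    proof
      fix y
      have "s + 1 + y = (s + y) + 1" by simp
      then show "K y * \<Phi> (s + y) + K y * c = K y * \<Phi> (s + 1 + y)"
        using per[of "s + y"] by (simp only: distrib_left)
    qed
    ultimately have "((\<lambda>y. K y * \<Phi> (s + 1 + y)) has_integral (\<Psi> s + 1 * c)) I" by simp
    from has_integral_unique[OF avg this] show ?thesis by simp
  qed
  \<comment> \<open>Convolution preserves the gain c per period, so b controls c.\<close>
  have cb: "\<bar>c\<bar> \<le> b" using bound[of 0 1] perPsi[of 0] by simp
  define S where "S = {\<bar>\<Phi> t - \<Phi> s\<bar> | s t. s \<le> t \<and> t \<le> s + 1}"
  \<comment> \<open>Finiteness of the supremum is what allows the inequality for M to be solved at
    the end.\<close>
  have bdd: "bdd_above S"
  proof (rule bdd_aboveI[where M="\<bar>c\<bar> + 1"])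
    fix z assume "z \<in> S"
    then obtain s t where st: "z = \<bar>\<Phi> t - \<Phi> s\<bar>" "s \<le> t" "t \<le> s + 1" by (auto simp: S_def)
    show "z \<le> \<bar>c\<bar> + 1" using low[of s t] low[of t "s + 1"] per[of s] st by auto
  qed
  define M where "M = Sup S"
  have le_M: "\<bar>\<Phi> t - \<Phi> s\<bar> \<le> M" if "s \<le> t" "t \<le> s + 1" for s t
    unfolding M_def by (rule cSup_upper[OF _ bdd]) (use that in \<open>auto simp: S_def\<close>)
  have M0: "0 \<le> M" using le_M[of 0 0] by simp
  \<comment> \<open>averaging a lower bound for the increment over the shifted pair \<open>(p + y, q + y)\<close>,
      which is at least \<open>\<Delta> - 2 \<epsilon>\<close> for small \<open>y\<close> and at least \<open>- M\<close> always\<close>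
  have core: "\<Delta> \<le> b + 2 * \<epsilon> + 2 * \<tau> * M"
    if D: "\<bar>\<Delta>\<bar> \<le> M" and PQ: "\<bar>\<Psi> q - \<Psi> p\<bar> \<le> b"
      and small: "\<And>y. \<bar>y\<bar> \<le> \<epsilon> \<Longrightarrow> \<Delta> - 2 * \<epsilon> \<le> \<sigma> * (\<Phi> (q + y) - \<Phi> (p + y))"
      and large: "\<And>y. - M \<le> \<sigma> * (\<Phi> (q + y) - \<Phi> (p + y))" and sg: "\<sigma> = 1 \<or> \<sigma> = -1" for \<Delta> p q \<sigma>
  proof -
    have i1: "((\<lambda>y. \<sigma> * (K y * \<Phi> (q + y) - K y * \<Phi> (p + y))) has_integral \<sigma> * (\<Psi> q - \<Psi> p)) I"
      by (intro has_integral_mult_right has_integral_diff avg)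
    \<comment> \<open>As g >= 1 off [-\<epsilon>, \<epsilon>], this single integrand lies below the
      averaged increment in both ranges of y, and its integral is explicit.\<close>
    have i2: "((\<lambda>y. K y * (\<Delta> - 2 * \<epsilon>) - (K y * g y) * (\<Delta> + M)) has_integral (1 * (\<Delta> - 2 * \<epsilon>) - \<tau> * (\<Delta> + M))) I"
      by (intro has_integral_diff has_integral_mult_left K1 tail)
    have "1 * (\<Delta> - 2 * \<epsilon>) - \<tau> * (\<Delta> + M) \<le> \<sigma> * (\<Psi> q - \<Psi> p)"
    proof (rule has_integral_le[OF i2 i1])
      fix y assume y: "y \<in> I"
      have "(\<Delta> - 2 * \<epsilon>) - g y * (\<Delta> + M) \<le> \<sigma> * (\<Phi> (q + y) - \<Phi> (p + y))"
      proof (cases "\<bar>y\<bar> \<le> \<epsilon>")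
        case True
        have "0 \<le> g y * (\<Delta> + M)" using D chi0 by (intro mult_nonneg_nonneg) auto
        then show ?thesis using small[OF True] by simp
      next
        case False
        then have "1 * (\<Delta> + M) \<le> g y * (\<Delta> + M)"
          using D y by (intro mult_right_mono chi1) auto
        then show ?thesis using large[of y] eps by simp
      qed
      from mult_left_mono[OF this K0[of y]]
      show "K y * (\<Delta> - 2 * \<epsilon>) - K y * g y * (\<Delta> + M) \<le> \<sigma> * (K y * \<Phi> (q + y) - K y * \<Phi> (p + y))"
        by (simp add: algebra_simps)
    qed
    moreover have "\<sigma> * (\<Psi> q - \<Psi> p) \<le> b" using PQ sg by auto
    moreover have "\<tau> * (\<Delta> + M) \<le> \<tau> * (2 * M)" using D tau0 by (intro mult_left_mono) auto
    ultimately show ?thesis by simp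
  qed
  have tM: "0 \<le> 2 * \<tau> * M" using tau0 M0 by simp
  have "\<bar>\<Phi> t - \<Phi> s\<bar> \<le> b + 2 * \<epsilon> + 2 * \<tau> * M" if st: "s \<le> t" "t \<le> s + 1" for s t
  proof -
    have "\<Phi> t - \<Phi> s \<le> b + 2 * \<epsilon> + 2 * \<tau> * M"
    proof (cases "t + \<epsilon> \<le> s - \<epsilon> + 1")
      case True
      show ?thesis
      proof (rule core[where q="t + \<epsilon>" and p="s - \<epsilon>" and \<sigma>=1])
        show "\<bar>\<Psi> (t + \<epsilon>) - \<Psi> (s - \<epsilon>)\<bar> \<le> b" using st eps True by (intro bound) auto
        show "\<Phi> t - \<Phi> s - 2 * \<epsilon> \<le> 1 * (\<Phi> (t + \<epsilon> + y) - \<Phi> (s - \<epsilon> + y))" if "\<bar>y\<bar> \<le> \<epsilon>" for y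
          using low[of t "t + \<epsilon> + y"] low[of "s - \<epsilon> + y" s] that by (simp add: abs_le_iff)
        show "- M \<le> 1 * (\<Phi> (t + \<epsilon> + y) - \<Phi> (s - \<epsilon> + y))" for y
          using le_M[of "s - \<epsilon> + y" "t + \<epsilon> + y"] st eps True by auto
      qed (use le_M[OF st] in auto)
    next
      \<comment> \<open>The pair is too wide to be enlarged: t lies within 2 \<epsilon> of s + 1, so
        \<Phi> t is compared with \<Phi> (s + 1) = \<Phi> s + c.\<close>
      case False
      then show ?thesis using low[of t "s + 1"] per[of s] st cb tM by linarith
    qed
    moreover have "\<Phi> s - \<Phi> t \<le> b + 2 * \<epsilon> + 2 * \<tau> * M"
    proof (cases "s + \<epsilon> \<le> t - \<epsilon>")
      case True
      show ?thesis
      proof (rule core[where q="t - \<epsilon>" and p="s + \<epsilon>" and \<sigma>="-1"])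
        show "\<bar>\<Psi> (t - \<epsilon>) - \<Psi> (s + \<epsilon>)\<bar> \<le> b" using st eps True by (intro bound) auto
        show "\<Phi> s - \<Phi> t - 2 * \<epsilon> \<le> -1 * (\<Phi> (t - \<epsilon> + y) - \<Phi> (s + \<epsilon> + y))" if "\<bar>y\<bar> \<le> \<epsilon>" for y
          using low[of "t - \<epsilon> + y" t] low[of s "s + \<epsilon> + y"] that by (simp add: abs_le_iff)
        show "- M \<le> -1 * (\<Phi> (t - \<epsilon> + y) - \<Phi> (s + \<epsilon> + y))" for y
          using le_M[of "s + \<epsilon> + y" "t - \<epsilon> + y"] st eps True by auto
      qed (use le_M[OF st] in auto)
    next
      case False
      then show ?thesis using low[of s t] st b0 tM by linarith
    qed
    ultimately show ?thesis by simp
  qed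
  then have "M \<le> b + 2 * \<epsilon> + 2 * \<tau> * M"
    unfolding M_def
  proof (intro cSup_least)
    have "\<bar>\<Phi> 0 - \<Phi> 0\<bar> \<in> S" unfolding S_def by force
    then show "S \<noteq> {}" by blast
  qed (auto simp: S_def)
  then have "M \<le> (b + 2 * \<epsilon>) / (1 - 2 * \<tau>)" using tau by (simp add: field_simps)
  then show ?thesis using le_M[OF uv] by simp
qed

section \<open>A nonnegative trigonometric kernel, its primitive and its action on the
  ceiling\<close>

lemma has_integral_cos_unit_period:
  "((\<lambda>y. cos (2 * pi * of_int m * y)) has_integral (if m = 0 then 1 else 0)) {-1/2..1/2::real}"
proof (cases "m = 0")
  case True
  then show ?thesis using has_integral_const_real[of "1::real" "-1/2" "1/2"] by simp
next
  case False
  let ?F = "\<lambda>y. sin (2 * pi * of_int m * y) / (2 * pi * of_int m)"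
  have "((\<lambda>y. cos (2 * pi * of_int m * y)) has_integral (?F (1/2) - ?F (-1/2))) {-1/2..1/2}"
  proof (rule fundamental_theorem_of_calculus)
    show "(?F has_vector_derivative cos (2 * pi * of_int m * y)) (at y within {-1/2..1/2})" for y
      unfolding has_real_derivative_iff_has_vector_derivative[symmetric]
      by (rule derivative_eq_intros refl | use False in simp)+
  qed simp
  then show ?thesis using False sin_int_times_real[of m] by (simp add: mult.commute)
qed

text \<open>The explicit coefficients are forgotten from here on; concentration near 0 is measured
  later through a hypothesis on \<open>\<kappa> 1\<close>.\<close>

locale smoothing_kernel =
  fixes L :: nat and \<kappa> :: "int \<Rightarrow> real"
  assumes \<kappa>0: "\<kappa> 0 = 1" and \<kappa>_minus: "\<And>h. \<kappa> (- h) = \<kappa> h" and \<kappa>_le: "\<And>h. \<bar>\<kappa> h\<bar> \<le> 1"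
    and ker_nonneg: "\<And>y. 0 \<le> (\<Sum>h\<in>{- int L..int L}. \<kappa> h * cos (2 * pi * of_int h * y))"
begin

definition ker :: "real \<Rightarrow> real" where
  "ker y = (\<Sum>h\<in>{- int L..int L}. \<kappa> h * cos (2 * pi * of_int h * y))"

text \<open>The antiderivative of \<open>ker\<close> normalised to be odd. It gains 1 per period
  like the ceiling, whose smoothed version it is up to a constant
  (\<open>ker_ceiling_integral\<close>).\<close>

definition prim :: "real \<Rightarrow> real" where
  "prim s = s + (\<Sum>h\<in>{- int L..int L} - {0}. \<kappa> h * (sin (2 * pi * of_int h * s) / (2 * pi * of_int h)))"

lemma ker_ge_0: "0 \<le> ker y"
  using ker_nonneg by (simp add: ker_def)

lemma prim_deriv: "(prim has_real_derivative ker s) (at s within A)"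
proof -
  have "ker s = 1 + (\<Sum>h\<in>{- int L..int L} - {0}. \<kappa> h * cos (2 * pi * of_int h * s))"
    unfolding ker_def by (subst sum.remove[of _ 0]) (auto simp: \<kappa>0)
  moreover have "(prim has_real_derivative
      1 + (\<Sum>h\<in>{- int L..int L} - {0}. \<kappa> h * cos (2 * pi * of_int h * s))) (at s within A)"
    unfolding prim_def
  proof (intro DERIV_add DERIV_ident DERIV_sum DERIV_cmult)
    fix h :: int assume "h \<in> {- int L..int L} - {0}"
    then show "((\<lambda>s. sin (2 * pi * of_int h * s) / (2 * pi * of_int h)) has_real_derivative
        cos (2 * pi * of_int h * s)) (at s within A)"
      by (auto intro!: derivative_eq_intros)
  qed
  ultimately show ?thesis by simp
qed

lemma prim_minus: "prim (- s) = - prim s"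
  by (simp add: prim_def sum_negf)

lemma prim_plus_int: "prim (s + of_int m) = prim s + of_int m"
proof -
  have "sin (2 * pi * of_int h * (s + of_int m)) = sin (2 * pi * of_int h * s)" for h :: int
  proof -
    have "2 * pi * of_int h * (s + of_int m) = 2 * pi * of_int h * s + 2 * pi * of_int (h * m)"
      by (simp add: algebra_simps)
    then show ?thesis by (simp only: sin_add sin_int_2pin cos_int_2pin)
  qed
  then show ?thesis by (simp add: prim_def)
qed

lemma prim_mono: "s \<le> t \<Longrightarrow> prim s \<le> prim t"
  by (rule DERIV_nonneg_imp_nondecreasing) (use prim_deriv ker_ge_0 in blast)+

lemma ker_integral: "s \<le> t \<Longrightarrow> (ker has_integral (prim t - prim s)) {s..t}"
  by (rule fundamental_theorem_of_calculus)
    (use prim_deriv in \<open>simp_all flip: has_real_derivative_iff_has_vector_derivative\<close>)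

lemma prim_half: "prim (1/2) - prim (-1/2) = 1"
  using prim_plus_int[of "-1/2" 1] by simp

text \<open>Orthogonality leaves only the frequencies 1 and -1, which are in range because 1 <= L.
  Hence \<open>ker\<close> has integral 1 - \<open>\<kappa> 1\<close> against 1 - cos (2 pi y), the
  quantity behind the Chebyshev estimate.\<close>

lemma ker_cos_integral:
  assumes "1 \<le> L"
  shows "((\<lambda>y. ker y * cos (2 * pi * y)) has_integral \<kappa> 1) {-1/2..1/2}"
proof -
  let ?c = "\<lambda>m y. cos (2 * pi * of_int m * y) :: real" and ?H = "{- int L..int L}"
  let ?d = "\<lambda>m::int. if m = 0 then 1 else 0 :: real"
  have "((\<lambda>y. \<Sum>h\<in>?H. \<kappa> h / 2 * (?c (h + 1) y + ?c (h - 1) y)) has_integral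
      (\<Sum>h\<in>?H. \<kappa> h / 2 * (?d (h + 1) + ?d (h - 1)))) {-1/2..1/2}"
    by (intro has_integral_sum has_integral_mult_right has_integral_add has_integral_cos_unit_period) simp
  moreover have "(\<lambda>y. \<Sum>h\<in>?H. \<kappa> h / 2 * (?c (h + 1) y + ?c (h - 1) y)) = (\<lambda>y. ker y * cos (2 * pi * y))"
    unfolding ker_def sum_distrib_right
    by (intro ext sum.cong refl) (simp add: cos_add cos_diff algebra_simps)
  moreover have "(\<Sum>h\<in>?H. \<kappa> h / 2 * (?d (h + 1) + ?d (h - 1)))
      = (\<Sum>h\<in>?H. \<kappa> h / 2 * of_bool (h = -1)) + (\<Sum>h\<in>?H. \<kappa> h / 2 * of_bool (h = 1))"
    unfolding sum.distrib[symmetric] by (intro sum.cong) auto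
  moreover have "\<dots> = \<kappa> 1"
    using assms \<kappa>_minus[of 1] by (simp add: sum.delta of_bool_def if_distrib cong: if_cong)
  ultimately show ?thesis by simp
qed

text \<open>Over one period s + y passes a single integer m, at y = y0: the ceiling is m before and
  m + 1 after, so the integral splits there. Oddness and \<open>prim_plus_int\<close> evaluate
  \<open>prim y0\<close>.\<close>

lemma ker_ceiling_integral:
  "((\<lambda>y. ker y * of_int \<lceil>s + y\<rceil>) has_integral (prim s + prim (1/2))) {-1/2..1/2}"
proof -
  define m where "m = \<lceil>s - 1/2\<rceil>"
  define y0 where "y0 = of_int m - s"
  have y0: "-1/2 \<le> y0" "y0 \<le> 1/2" "of_int m = s + y0"
    unfolding y0_def m_def by linarith+
  have "((\<lambda>y. ker y * of_int m) has_integral (prim y0 - prim (-1/2)) * of_int m) {-1/2..y0}"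
    by (intro has_integral_mult_left ker_integral y0)
  then have 1: "((\<lambda>y. ker y * of_int \<lceil>s + y\<rceil>) has_integral (prim y0 - prim (-1/2)) * of_int m) {-1/2..y0}"
  proof (rule has_integral_spike_finite[of "{-1/2}", rotated 2])
    fix y assume "y \<in> {-1/2..y0} - {-1/2}"
    then have "\<lceil>s + y\<rceil> = m" using y0 by (intro ceiling_unique) auto
    then show "ker y * of_int \<lceil>s + y\<rceil> = ker y * of_int m" by simp
  qed simp
  have "((\<lambda>y. ker y * of_int (m + 1)) has_integral (prim (1/2) - prim y0) * of_int (m + 1)) {y0..1/2}"
    by (intro has_integral_mult_left ker_integral y0)
  then have 2: "((\<lambda>y. ker y * of_int \<lceil>s + y\<rceil>) has_integral (prim (1/2) - prim y0) * of_int (m + 1)) {y0..1/2}"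
  proof (rule has_integral_spike_finite[of "{y0}", rotated 2])
    fix y assume "y \<in> {y0..1/2} - {y0}"
    then have "\<lceil>s + y\<rceil> = m + 1" using y0 by (intro ceiling_unique) auto
    then show "ker y * of_int \<lceil>s + y\<rceil> = ker y * of_int (m + 1)" by simp
  qed simp
  have "prim y0 = of_int m - prim s"
    using prim_plus_int[of "- s" m] by (simp add: y0_def prim_minus)
  then have "(prim y0 - prim (-1/2)) * of_int m + (prim (1/2) - prim y0) * of_int (m + 1)
      = prim s + prim (1/2) + (prim (1/2) - prim (-1/2) - 1) * of_int m"
    by (simp add: algebra_simps)
  then show ?thesis
    using has_integral_combine[OF y0(1,2) 1 2] prim_half by simp
qed

text \<open>Ceiling differences count the integer translates of \<open>f x\<close> in [u, v), so
  this is a weighted discrepancy in one coordinate; \<open>smooth\<close> is the same with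
  \<open>prim\<close>. In the application \<open>q\<close> and \<open>W\<close> carry the factors of
  all other coordinates.\<close>

lemma discrepancy_step:
  fixes q f :: "'a \<Rightarrow> real"
  assumes L: "1 \<le> L" and eps: "0 < \<epsilon>" "\<epsilon> \<le> 1/2"
    and tail: "1 - \<kappa> 1 \<le> \<tau> * (1 - cos (2 * pi * \<epsilon>))" and \<tau>: "2 * \<tau> < 1"
    and X: "finite X" and q: "\<And>x. x \<in> X \<Longrightarrow> 0 \<le> q x" and W: "0 \<le> W" "W \<le> 1"
    and smooth: "\<And>u v. u \<le> v \<Longrightarrow> v \<le> u + 1 \<Longrightarrow>
        \<bar>(\<Sum>x\<in>X. q x * (prim (v - f x) - prim (u - f x))) - W * (v - u)\<bar> \<le> b"
    and uv: "u \<le> v" "v \<le> u + 1"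
  shows "\<bar>(\<Sum>x\<in>X. q x * (of_int \<lceil>v - f x\<rceil> - of_int \<lceil>u - f x\<rceil>)) - W * (v - u)\<bar>
    \<le> (b + 2 * \<epsilon>) / (1 - 2 * \<tau>)"
proof -
  define I where "I = {-1/2..1/2::real}"
  define \<Phi> where "\<Phi> s = (\<Sum>x\<in>X. q x * of_int \<lceil>s - f x\<rceil>) - W * s" for s
  \<comment> \<open>The first moment of the kernel enters \<Psi> as an additive constant and cancels
    in every increment.\<close>
  obtain \<mu> where \<mu>: "((\<lambda>y. ker y * y) has_integral \<mu>) I"
  proof -
    have "continuous_on I (\<lambda>y. ker y * y)"
      unfolding ker_def by (intro continuous_intros)
    then have "(\<lambda>y. ker y * y) integrable_on I"
      unfolding I_def by (rule integrable_continuous_real)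
    then show ?thesis using that by (auto simp: integrable_on_def)
  qed
  define \<Psi> where
    "\<Psi> s = (\<Sum>x\<in>X. q x * (prim (s - f x) + prim (1/2))) - W * (s + \<mu>)" for s
  have one: "(ker has_integral 1) I"
    using ker_integral[of "-1/2" "1/2"] prim_half by (simp add: I_def)
  define D where "D = 1 - cos (2 * pi * \<epsilon>)"
  have "cos (2 * pi * \<epsilon>) < cos 0"
    using eps by (intro cos_monotone_0_pi) auto
  then have D: "0 < D" by (simp add: D_def)
  have \<tau>': "(1 - \<kappa> 1) / D \<le> \<tau>" using tail D by (simp add: D_def pos_divide_le_eq)
  \<comment> \<open>The Chebyshev weight g equals 1 at |y| = \<epsilon> and increases up to |y| =
    1/2. The bounds 0 <= W <= 1 limit the descent of \<Phi> to slope 1.\<close>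
  have "\<bar>\<Phi> v - \<Phi> u\<bar> \<le> (b + 2 * \<epsilon>) / (1 - 2 * ((1 - \<kappa> 1) / D))"
  proof (rule esseen_smoothing[where K=ker and \<Phi>=\<Phi> and \<Psi>=\<Psi> and u=u and v=v and b=b and \<epsilon>=\<epsilon> and g="\<lambda>y. (1 - cos (2 * pi * y)) / D"
        and c="(\<Sum>x\<in>X. q x) - W"])
    show "(ker has_integral 1) {-1/2..1/2}" using one by (simp add: I_def)
    show "0 \<le> (1 - cos (2 * pi * y)) / D" for y using D by simp
    show "1 \<le> (1 - cos (2 * pi * y)) / D" if "y \<in> {-1/2..1/2}" "\<epsilon> < \<bar>y\<bar>" for y
    proof -
      have "cos (2 * pi * \<bar>y\<bar>) \<le> cos (2 * pi * \<epsilon>)"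
        using that eps by (intro cos_monotone_0_pi_le) auto
      moreover have "cos (2 * pi * \<bar>y\<bar>) = cos (2 * pi * y)" by (cases "0 \<le> y") auto
      ultimately show ?thesis using D by (simp add: D_def field_simps)
    qed
    show "((\<lambda>y. ker y * ((1 - cos (2 * pi * y)) / D)) has_integral (1 - \<kappa> 1) / D) {-1/2..1/2}"
      using has_integral_divide[OF has_integral_diff[OF one[unfolded I_def] ker_cos_integral[OF L]], of D]
      by (simp add: right_diff_distrib)
    show "\<Phi> s - (t - s) \<le> \<Phi> t" if "s \<le> t" for s t
    proof -
      have "(\<Sum>x\<in>X. q x * of_int \<lceil>s - f x\<rceil>) \<le> (\<Sum>x\<in>X. q x * of_int \<lceil>t - f x\<rceil>)"
        using that by (intro sum_mono mult_left_mono q) (auto intro!: ceiling_mono)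
      moreover have "W * (t - s) \<le> 1 * (t - s)"
        using that W by (intro mult_right_mono) auto
      ultimately show ?thesis by (simp add: \<Phi>_def algebra_simps)
    qed
    show "\<Phi> (s + 1) = \<Phi> s + ((\<Sum>x\<in>X. q x) - W)" for s
    proof -
      have "\<lceil>s + 1 - f x\<rceil> = \<lceil>s - f x\<rceil> + 1" for x
        using ceiling_add_one[of "s - f x"] by (simp add: algebra_simps)
      then show ?thesis by (simp add: \<Phi>_def algebra_simps sum.distrib)
    qed
    show "((\<lambda>y. ker y * \<Phi> (s + y)) has_integral \<Psi> s) {-1/2..1/2}" for s
    proof -
      have 1: "((\<lambda>y. \<Sum>x\<in>X. q x * (ker y * of_int \<lceil>(s - f x) + y\<rceil>))
          has_integral (\<Sum>x\<in>X. q x * (prim (s - f x) + prim (1/2)))) I"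
        unfolding I_def
      proof (rule has_integral_sum[OF X])
        fix x
        show "((\<lambda>y. q x * (ker y * of_int \<lceil>(s - f x) + y\<rceil>))
            has_integral q x * (prim (s - f x) + prim (1/2))) {-1/2..1/2}"
          by (rule has_integral_mult_right[OF ker_ceiling_integral])
      qed
      have 2: "((\<lambda>y. W * (ker y * s + ker y * y)) has_integral W * (1 * s + \<mu>)) I"
        by (rule has_integral_mult_right[OF has_integral_add[OF has_integral_mult_left[OF one] \<mu>]])
      from has_integral_diff[OF 1 2] have "((\<lambda>y. (\<Sum>x\<in>X. q x * (ker y * of_int \<lceil>(s - f x) + y\<rceil>)) - W * (ker y * s + ker y * y))
          has_integral (\<Sum>x\<in>X. q x * (prim (s - f x) + prim (1/2))) - W * (1 * s + \<mu>)) I" .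
      moreover have "(\<lambda>y. (\<Sum>x\<in>X. q x * (ker y * of_int \<lceil>(s - f x) + y\<rceil>)) - W * (ker y * s + ker y * y))
          = (\<lambda>y. ker y * \<Phi> (s + y))"
      proof
        fix y
        have "s - f x + y = s + y - f x" for x by simp
        then show "(\<Sum>x\<in>X. q x * (ker y * of_int \<lceil>s - f x + y\<rceil>)) - W * (ker y * s + ker y * y)
            = ker y * \<Phi> (s + y)"
          by (simp only: \<Phi>_def right_diff_distrib sum_distrib_left) (simp add: algebra_simps)
      qed
      ultimately show ?thesis by (simp add: \<Psi>_def I_def)
    qed
    show "\<bar>\<Psi> t - \<Psi> s\<bar> \<le> b" if "s \<le> t" "t \<le> s + 1" for s t
    proof -
      have "\<Psi> t - \<Psi> s = (\<Sum>x\<in>X. q x * (prim (t - f x) - prim (s - f x))) - W * (t - s)"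
        by (simp add: \<Psi>_def algebra_simps sum.distrib sum_subtractf)
      then show ?thesis using smooth[OF that] by simp
    qed
    show "2 * ((1 - \<kappa> 1) / D) < 1" using \<tau>' \<tau> by linarith
  qed (use ker_ge_0 eps uv in auto)
  also have "\<dots> \<le> (b + 2 * \<epsilon>) / (1 - 2 * \<tau>)"
  proof (rule divide_left_mono)
    show "1 - 2 * \<tau> \<le> 1 - 2 * ((1 - \<kappa> 1) / D)" using \<tau>' by linarith
    show "0 < (1 - 2 * ((1 - \<kappa> 1) / D)) * (1 - 2 * \<tau>)"
      using \<tau>' \<tau> by (intro mult_pos_pos; linarith)
    show "0 \<le> b + 2 * \<epsilon>" using smooth[of 0 0] eps by simp
  qed
  also have "\<Phi> v - \<Phi> u = (\<Sum>x\<in>X. q x * (of_int \<lceil>v - f x\<rceil> - of_int \<lceil>u - f x\<rceil>)) - W * (v - u)"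
    by (simp add: \<Phi>_def algebra_simps sum_subtractf)
  finally show ?thesis .
qed

section \<open>Fourier coefficients of a smoothed interval\<close>

definition coef :: "real \<Rightarrow> real \<Rightarrow> int \<Rightarrow> complex" where
  "coef u v h = (if h = 0 then of_real (v - u)
     else of_real (\<kappa> h) * (cis (2 * pi * of_int h * v) - cis (2 * pi * of_int h * u))
       / (2 * of_real pi * \<i> * of_int h))"

lemma norm_coef_le:
  assumes "h \<noteq> 0"
  shows "cmod (coef u v h) \<le> 1 / (pi * \<bar>of_int h\<bar>)"
proof -
  have "cmod (cis (2 * pi * of_int h * v) - cis (2 * pi * of_int h * u)) \<le> 2"
    using norm_triangle_ineq4[of "cis (2 * pi * of_int h * v)" "cis (2 * pi * of_int h * u)"] by simp
  then have "\<bar>\<kappa> h\<bar> * cmod (cis (2 * pi * of_int h * v) - cis (2 * pi * of_int h * u)) \<le> 1 * 2"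
    using \<kappa>_le[of h] by (intro mult_mono) auto
  then show ?thesis
    using assms by (simp add: coef_def norm_mult norm_divide divide_simps)
qed

lemma norm_coef_le_1:
  assumes "u \<le> v" "v \<le> u + 1"
  shows "cmod (coef u v h) \<le> 1"
proof (cases "h = 0")
  case True
  then have "cmod (coef u v h) = \<bar>v - u\<bar>"
    unfolding coef_def by (simp only: norm_of_real if_True refl)
  then show ?thesis using assms by simp
next
  case False
  then have "1 \<le> \<bar>real_of_int h\<bar>" by linarith
  then have "1 * 1 \<le> pi * \<bar>real_of_int h\<bar>"
    using pi_ge_two by (intro mult_mono) auto
  then have "1 / (pi * \<bar>real_of_int h\<bar>) \<le> 1" by simp
  then show ?thesis using norm_coef_le[OF False, of u v] by linarith
qed

text \<open>The periodised indicator of [u, v), once smoothed, is a trigonometric polynomial of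
  degree at most L: convolution multiplies each sharp coefficient by
  \<open>\<kappa> h\<close>.\<close>

lemma prim_diff_expansion:
  "complex_of_real (prim (v - x) - prim (u - x))
    = (\<Sum>h\<in>{- int L..int L}. coef u v h * cis (- (2 * pi * of_int h * x)))"
proof -
  let ?H = "{- int L..int L} - {0}"
  let ?E = "\<lambda>s h. of_real (\<kappa> h) * cis (2 * pi * of_int h * s) / (2 * of_real pi * \<i> * of_int h)"
  have E: "complex_of_real (prim s) = of_real s + (\<Sum>h\<in>?H. ?E s h)" for s
  proof -
    let ?c = "\<lambda>h::int. \<kappa> h * cos (2 * pi * of_int h * s) / (2 * pi * of_int h)"
    \<comment> \<open>Evenness of \<kappa> makes the cosine parts cancel between h and -h, so the
      sine sum in \<open>prim\<close> may be written with \<open>cis\<close>.\<close>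
    have "(\<Sum>h\<in>?H. ?c h) = (\<Sum>h\<in>?H. ?c (- h))"
      by (rule sum.reindex_bij_witness[where i=uminus and j=uminus]) auto
    also have "\<dots> = - (\<Sum>h\<in>?H. ?c h)" by (simp add: \<kappa>_minus sum_negf)
    finally have 0: "(\<Sum>h\<in>?H. ?c h) = 0" by simp
    have "?E s h = of_real (\<kappa> h * (sin (2 * pi * of_int h * s) / (2 * pi * of_int h))) - \<i> * of_real (?c h)"
      if "h \<in> ?H" for h
      using that by (simp add: complex_eq_iff cis.ctr Re_divide Im_divide power2_eq_square field_simps)
    then have "(\<Sum>h\<in>?H. ?E s h) = (\<Sum>h\<in>?H. of_real (\<kappa> h * (sin (2 * pi * of_int h * s) / (2 * pi * of_int h))))
        - (\<Sum>h\<in>?H. \<i> * of_real (?c h))"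
      by (simp add: sum_subtractf)
    also have "\<dots> = of_real (\<Sum>h\<in>?H. \<kappa> h * (sin (2 * pi * of_int h * s) / (2 * pi * of_int h)))
        - \<i> * of_real (\<Sum>h\<in>?H. ?c h)"
      by (simp only: of_real_sum sum_distrib_left)
    finally show ?thesis by (simp only: 0 prim_def) simp
  qed
  have "complex_of_real (prim (v - x) - prim (u - x)) = of_real (v - u) + (\<Sum>h\<in>?H. ?E (v - x) h - ?E (u - x) h)"
    by (simp add: E sum_subtractf)
  also have "(\<Sum>h\<in>?H. ?E (v - x) h - ?E (u - x) h) = (\<Sum>h\<in>?H. coef u v h * cis (- (2 * pi * of_int h * x)))"
  proof (rule sum.cong)
    fix h assume h: "h \<in> ?H"
    have c: "cis (2 * pi * of_int h * (s - x)) = cis (2 * pi * of_int h * s) * cis (- (2 * pi * of_int h * x))" for s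
      by (simp add: cis_mult right_diff_distrib)
    have e: "k * (a * c) / w - k * (b * c) / w = k * (a - b) / w * c" for k a b c w :: complex
      by (simp add: diff_divide_distrib right_diff_distrib left_diff_distrib mult.assoc)
    have "h \<noteq> 0" using h by simp
    then show "?E (v - x) h - ?E (u - x) h = coef u v h * cis (- (2 * pi * of_int h * x))"
      by (simp only: coef_def c e if_False)
  qed simp
  also have "of_real (v - u) + \<dots> = (\<Sum>h\<in>{- int L..int L}. coef u v h * cis (- (2 * pi * of_int h * x)))"
    by (subst (2) sum.remove[of _ 0]) (auto simp: coef_def)
  finally show ?thesis .
qed

end

section \<open>Boxes in several dimensions\<close>

text \<open>Frequencies are functions rather than vectors, so that a cube of them is a
  \<open>PiE\<close> set and \<open>prod_sum_PiE\<close> turns products of one-dimensional sums into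
  sums over the cube.\<close>

definition int_norm :: "('d::finite \<Rightarrow> int) \<Rightarrow> int" where
  "int_norm h = Max (range (\<lambda>i. \<bar>h i\<bar>))"

lemma int_norm_attained: obtains i where "\<bar>h i\<bar> = int_norm h"
proof -
  have "int_norm h \<in> range (\<lambda>i. \<bar>h i\<bar>)" unfolding int_norm_def by (intro Max_in) auto
  then show ?thesis using that by auto
qed

lemma abs_le_int_norm: "\<bar>h i\<bar> \<le> int_norm h"
  unfolding int_norm_def by (intro Max_ge) auto

lemma int_norm_pos: "h \<noteq> (\<lambda>_. 0) \<Longrightarrow> 1 \<le> int_norm h"
proof -
  assume "h \<noteq> (\<lambda>_. 0)"
  then obtain i where "h i \<noteq> 0" by auto
  then show ?thesis using abs_le_int_norm[of h i] by linarith
qed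

definition torus_char :: "('d::finite \<Rightarrow> int) \<Rightarrow> real^'d \<Rightarrow> complex" where
  "torus_char h x = cis (- (2 * pi * (\<Sum>i\<in>UNIV. of_int (h i) * x $ i)))"

lemma cis_sum: "cis (\<Sum>i\<in>A. f i) = (\<Prod>i\<in>A. cis (f i))"
  by (induction A rule: infinite_finite_induct) (simp_all flip: cis_mult)

context smoothing_kernel
begin

text \<open>Coordinates in \<open>T\<close> carry sharp factors, the others smoothed ones. Induction
  on \<open>T\<close> sharpens one coordinate at a time, and the bound passes through the same
  affine map each time.\<close>

lemma coordinatewise_discrepancy:
  fixes X :: "(real^'d) set" and p :: "real^'d \<Rightarrow> real" and u v :: "'d \<Rightarrow> real" and T :: "'d set"
  assumes L: "1 \<le> L" and eps: "0 < \<epsilon>" "\<epsilon> \<le> 1/2"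
    and tail: "1 - \<kappa> 1 \<le> \<tau> * (1 - cos (2 * pi * \<epsilon>))" and \<tau>: "2 * \<tau> < 1"
    and X: "finite X" and p: "\<And>x. 0 \<le> p x"
    and smooth: "\<And>u v. (\<And>i. u i \<le> v i \<and> v i \<le> u i + 1) \<Longrightarrow>
      \<bar>(\<Sum>x\<in>X. p x * (\<Prod>i\<in>UNIV. prim (v i - x $ i) - prim (u i - x $ i))) - (\<Prod>i\<in>UNIV. v i - u i)\<bar> \<le> b"
    and uv: "\<And>i. u i \<le> v i \<and> v i \<le> u i + 1"
  shows "\<bar>(\<Sum>x\<in>X. p x * (\<Prod>i\<in>UNIV. if i \<in> T then of_int \<lceil>v i - x $ i\<rceil> - of_int \<lceil>u i - x $ i\<rceil>
            else prim (v i - x $ i) - prim (u i - x $ i))) - (\<Prod>i\<in>UNIV. v i - u i)\<bar>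
    \<le> ((\<lambda>y. (y + 2 * \<epsilon>) / (1 - 2 * \<tau>)) ^^ card T) b"
proof -
  define fac where "fac T u v x i = (if i \<in> T then of_int \<lceil>v i - x $ i\<rceil> - of_int \<lceil>u i - x $ i\<rceil>
            else prim (v i - x $ i) - prim (u i - x $ i))" for T u v and x :: "real^'d" and i
  have "finite T" by simp
  then have "\<bar>(\<Sum>x\<in>X. p x * (\<Prod>i\<in>UNIV. fac T u v x i)) - (\<Prod>i\<in>UNIV. v i - u i)\<bar>
    \<le> ((\<lambda>y. (y + 2 * \<epsilon>) / (1 - 2 * \<tau>)) ^^ card T) b" using uv
  proof (induction T arbitrary: u v rule: finite_induct)
    case empty
    then show ?case using smooth by (simp add: fac_def)
  next
    case (insert j T)
    define q where "q x = p x * (\<Prod>i\<in>UNIV - {j}. fac T u v x i)" for x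
    define W where "W = (\<Prod>i\<in>UNIV - {j}. v i - u i)"
    have split: "(\<Prod>i\<in>UNIV. F i) = F j * (\<Prod>i\<in>UNIV - {j}. F i)" for F :: "'d \<Rightarrow> real"
      by (rule prod.remove) auto
    have W: "0 \<le> W" "W \<le> 1"
      unfolding W_def using insert.prems by (auto intro!: prod_nonneg prod_le_1 simp: algebra_simps)
    have "0 \<le> fac T u v x i" for x i
      using insert.prems by (auto simp: fac_def intro!: prim_mono ceiling_mono)
    then have q: "0 \<le> q x" for x
      unfolding q_def using p by (intro mult_nonneg_nonneg prod_nonneg) auto
    have "\<bar>(\<Sum>x\<in>X. q x * (of_int \<lceil>v j - x $ j\<rceil> - of_int \<lceil>u j - x $ j\<rceil>)) - W * (v j - u j)\<bar>
      \<le> ((((\<lambda>y. (y + 2 * \<epsilon>) / (1 - 2 * \<tau>)) ^^ card T) b) + 2 * \<epsilon>) / (1 - 2 * \<tau>)"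
    \<comment> \<open>The step in coordinate j needs the induction hypothesis for every interval [s,
      t) in that coordinate, hence the generalisation over \<open>u\<close> and
      \<open>v\<close>.\<close>
    proof (rule discrepancy_step[OF L eps tail \<tau> X q W])
      fix s t :: real assume st: "s \<le> t" "t \<le> s + 1"
      let ?u = "u(j := s)" and ?v = "v(j := t)"
      have "(\<Prod>i\<in>UNIV. fac T ?u ?v x i) = (prim (t - x $ j) - prim (s - x $ j)) * (\<Prod>i\<in>UNIV - {j}. fac T u v x i)" for x
        unfolding split using insert.hyps by (intro arg_cong2[where f="(*)"] prod.cong) (auto simp: fac_def)
      moreover have "(\<Prod>i\<in>UNIV. ?v i - ?u i) = (t - s) * W"
        unfolding split W_def by (intro arg_cong2[where f="(*)"] prod.cong) auto
      moreover have "\<bar>(\<Sum>x\<in>X. p x * (\<Prod>i\<in>UNIV. fac T ?u ?v x i)) - (\<Prod>i\<in>UNIV. ?v i - ?u i)\<bar>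
          \<le> ((\<lambda>y. (y + 2 * \<epsilon>) / (1 - 2 * \<tau>)) ^^ card T) b"
        using insert.prems st by (intro insert.IH) auto
      ultimately show "\<bar>(\<Sum>x\<in>X. q x * (prim (t - x $ j) - prim (s - x $ j))) - W * (t - s)\<bar>
          \<le> ((\<lambda>y. (y + 2 * \<epsilon>) / (1 - 2 * \<tau>)) ^^ card T) b"
        by (simp only: q_def) (simp only: ac_simps)
    qed (use insert.prems in auto)
    moreover have "(\<Prod>i\<in>UNIV. fac (insert j T) u v x i)
        = (of_int \<lceil>v j - x $ j\<rceil> - of_int \<lceil>u j - x $ j\<rceil>) * (\<Prod>i\<in>UNIV - {j}. fac T u v x i)" for x
      unfolding split by (intro arg_cong2[where f="(*)"] prod.cong) (auto simp: fac_def)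
    then have "p x * (\<Prod>i\<in>UNIV. fac (insert j T) u v x i)
        = q x * (of_int \<lceil>v j - x $ j\<rceil> - of_int \<lceil>u j - x $ j\<rceil>)" for x
      by (simp add: q_def)
    moreover have "(\<Prod>i\<in>UNIV. v i - u i) = W * (v j - u j)"
      unfolding split W_def by simp
    ultimately show ?case using insert.hyps by simp
  qed
  then show ?thesis by (simp add: fac_def)
qed

text \<open>Multiplying out the one-dimensional expansions gives a sum over a cube of frequencies,
  whose zero frequency produces exactly the volume of the box.\<close>

lemma smoothed_discrepancy:
  fixes X :: "(real^'d) set" and p :: "real^'d \<Rightarrow> real" and u v :: "'d \<Rightarrow> real"
  assumes X: "finite X" and p: "(\<Sum>x\<in>X. p x) = 1"
    and uv: "\<And>i. u i \<le> v i \<and> v i \<le> u i + 1"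
  defines "H \<equiv> UNIV \<rightarrow>\<^sub>E {- int L..int L}"
  shows "\<bar>(\<Sum>x\<in>X. p x * (\<Prod>i\<in>UNIV. prim (v i - x $ i) - prim (u i - x $ i))) - (\<Prod>i\<in>UNIV. v i - u i)\<bar>
    \<le> (\<Sum>h\<in>H - {\<lambda>_. 0}. cmod (\<Sum>x\<in>X. of_real (p x) * torus_char h x)
          / (pi * of_int (int_norm h)))"
proof -
  define G where "G h = (\<Prod>i\<in>UNIV. coef (u i) (v i) (h i))" for h :: "'d \<Rightarrow> int"
  have finH: "finite H" and zH: "(\<lambda>_. 0) \<in> H" by (auto simp: H_def intro!: finite_PiE)
  have expand: "complex_of_real (\<Prod>i\<in>UNIV. prim (v i - x $ i) - prim (u i - x $ i)) = (\<Sum>h\<in>H. G h * torus_char h x)" for x :: "real^'d"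
  proof -
    have "complex_of_real (\<Prod>i\<in>UNIV. prim (v i - x $ i) - prim (u i - x $ i))
      = (\<Prod>i\<in>UNIV. \<Sum>h\<in>{- int L..int L}. coef (u i) (v i) h * cis (- (2 * pi * of_int h * x $ i)))"
      by (simp only: of_real_prod prim_diff_expansion)
    also have "\<dots> = (\<Sum>h\<in>H. \<Prod>i\<in>UNIV. coef (u i) (v i) (h i) * cis (- (2 * pi * of_int (h i) * x $ i)))"
      unfolding H_def by (rule prod_sum_PiE) auto
    also have "\<dots> = (\<Sum>h\<in>H. G h * torus_char h x)"
    proof (rule sum.cong)
      fix h :: "'d \<Rightarrow> int"
      have "(\<Prod>i\<in>UNIV. cis (- (2 * pi * of_int (h i) * x $ i))) = torus_char h x"
        by (simp add: torus_char_def sum_distrib_left mult.assoc flip: cis_sum sum_negf)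
      then show "(\<Prod>i\<in>UNIV. coef (u i) (v i) (h i) * cis (- (2 * pi * of_int (h i) * x $ i))) = G h * torus_char h x"
        by (simp add: G_def prod.distrib)
    qed simp
    finally show ?thesis .
  qed
  have "complex_of_real ((\<Sum>x\<in>X. p x * (\<Prod>i\<in>UNIV. prim (v i - x $ i) - prim (u i - x $ i))))
      = (\<Sum>x\<in>X. \<Sum>h\<in>H. G h * (of_real (p x) * torus_char h x))"
    by (simp only: of_real_sum of_real_mult expand sum_distrib_left) (simp only: ac_simps)
  also have "\<dots> = (\<Sum>h\<in>H. G h * (\<Sum>x\<in>X. of_real (p x) * torus_char h x))"
    unfolding sum_distrib_left by (rule sum.swap)
  also have "\<dots> = G (\<lambda>_. 0) * (\<Sum>x\<in>X. of_real (p x)) + (\<Sum>h\<in>H - {\<lambda>_. 0}. G h * (\<Sum>x\<in>X. of_real (p x) * torus_char h x))"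
    using finH zH by (subst sum.remove[of _ "\<lambda>_. 0"]) (auto simp: torus_char_def)
  also have "G (\<lambda>_. 0) * (\<Sum>x\<in>X. of_real (p x)) = of_real (\<Prod>i\<in>UNIV. v i - u i)"
    unfolding of_real_sum[symmetric] p by (simp add: G_def coef_def)
  finally have "complex_of_real ((\<Sum>x\<in>X. p x * (\<Prod>i\<in>UNIV. prim (v i - x $ i) - prim (u i - x $ i))) - (\<Prod>i\<in>UNIV. v i - u i))
      = (\<Sum>h\<in>H - {\<lambda>_. 0}. G h * (\<Sum>x\<in>X. of_real (p x) * torus_char h x))"
    by (simp only: of_real_diff) simp
  from arg_cong[OF this, of cmod]
  have "\<bar>(\<Sum>x\<in>X. p x * (\<Prod>i\<in>UNIV. prim (v i - x $ i) - prim (u i - x $ i))) - (\<Prod>i\<in>UNIV. v i - u i)\<bar>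
      = cmod (\<Sum>h\<in>H - {\<lambda>_. 0}. G h * (\<Sum>x\<in>X. of_real (p x) * torus_char h x))"
    unfolding norm_of_real .
  also have "\<dots> \<le> (\<Sum>h\<in>H - {\<lambda>_. 0}. cmod (\<Sum>x\<in>X. of_real (p x) * torus_char h x) / (pi * of_int (int_norm h)))"
  proof (rule sum_norm_le)
    fix h assume h: "h \<in> H - {\<lambda>_. 0}"
    then have pos: "1 \<le> int_norm h" by (intro int_norm_pos) auto
    obtain j where j: "\<bar>h j\<bar> = int_norm h" by (rule int_norm_attained)
    \<comment> \<open>The coordinate of largest modulus supplies the weight; every other factor is
      bounded by 1.\<close>
    have "cmod (G h) = cmod (coef (u j) (v j) (h j)) * (\<Prod>i\<in>UNIV - {j}. cmod (coef (u i) (v i) (h i)))"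
      unfolding G_def prod_norm[symmetric] by (rule prod.remove) auto
    also have "\<dots> \<le> 1 / (pi * \<bar>of_int (h j)\<bar>) * 1"
      using pos j uv by (intro mult_mono norm_coef_le prod_le_1 prod_nonneg) (auto intro!: norm_coef_le_1)
    also have "\<dots> = 1 / (pi * of_int (int_norm h))" using j by (metis of_int_abs mult_1_right)
    finally have "cmod (G h) * cmod (\<Sum>x\<in>X. of_real (p x) * torus_char h x)
        \<le> 1 / (pi * of_int (int_norm h)) * cmod (\<Sum>x\<in>X. of_real (p x) * torus_char h x)"
      by (intro mult_right_mono) auto
    then show "cmod (G h * (\<Sum>x\<in>X. of_real (p x) * torus_char h x))
        \<le> cmod (\<Sum>x\<in>X. of_real (p x) * torus_char h x) / (pi * of_int (int_norm h))"
      by (simp add: norm_mult)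
  qed
  finally show ?thesis .
qed

end

section \<open>Fourier coefficients of the walk\<close>

lemma torus_char_add: "torus_char h (x + y) = torus_char h x * torus_char h y"
  by (simp add: torus_char_def cis_mult sum.distrib algebra_simps)

lemma torus_char_tmod: "torus_char h (tmod x) = torus_char h x"
proof -
  have "torus_char h x = torus_char h (tmod x) * torus_char h (x - tmod x)"
    by (simp flip: torus_char_add)
  also have "torus_char h (x - tmod x) = cis (2 * pi * of_int (- (\<Sum>i\<in>UNIV. h i * \<lfloor>x $ i\<rfloor>)))"
    by (simp add: torus_char_def tmod_def frac_def)
  also have "\<dots> = 1"
    by (intro cis_multiple_2pi) auto
  finally show ?thesis by simp
qed

definition fourier :: "('d::finite \<Rightarrow> int) \<Rightarrow> (real^'d) pmf \<Rightarrow> complex" where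
  "fourier h P = (\<Sum>x\<in>set_pmf P. of_real (pmf P x) * torus_char h x)"

lemma fourier_conv_expectation:
  "finite (set_pmf P) \<Longrightarrow> fourier h P = measure_pmf.expectation P (torus_char h)"
  unfolding fourier_def by (subst integral_measure_pmf[of "set_pmf P"]) (auto simp: scaleR_conv_of_real)

lemma fourier_torus_conv:
  assumes "finite (set_pmf P)" "finite (set_pmf R)"
  shows "fourier h (torus_conv P R) = fourier h P * fourier h R"
proof -
  have fin: "finite (set_pmf (torus_conv P R))"
    using assms by (simp add: torus_conv_def)
  have "fourier h (torus_conv P R)
      = measure_pmf.expectation (pair_pmf P R) (\<lambda>(x, y). torus_char h x * torus_char h y)"
    unfolding fourier_conv_expectation[OF fin]
    by (simp add: torus_conv_def case_prod_unfold torus_char_tmod torus_char_add)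
  also have "\<dots> = (\<Sum>(x, y)\<in>set_pmf P \<times> set_pmf R. (of_real (pmf P x) * torus_char h x) * (of_real (pmf R y) * torus_char h y))"
    using assms by (subst integral_measure_pmf[of "set_pmf P \<times> set_pmf R"])
      (auto simp: pmf_pair scaleR_conv_of_real algebra_simps intro!: sum.cong)
  also have "\<dots> = fourier h P * fourier h R"
    by (simp add: fourier_def sum_product sum.cartesian_product)
  finally show ?thesis .
qed

lemma finite_conv_power: "finite (set_pmf P) \<Longrightarrow> finite (set_pmf (conv_power P k))"
  by (induction k) (auto simp: torus_conv_def)

lemma fourier_conv_power:
  "finite (set_pmf P) \<Longrightarrow> fourier h (conv_power P k) = fourier h P ^ k"
proof (induction k)
  case 0
  then show ?case by (simp add: fourier_def torus_char_def)
next
  case (Suc k)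
  then show ?case by (simp add: fourier_torus_conv finite_conv_power)
qed

lemma conv_power_in_unit_cube: "x \<in> set_pmf (conv_power P k) \<Longrightarrow> 0 \<le> x $ i \<and> x $ i < 1"
  by (cases k) (auto simp: torus_conv_def tmod_def frac_lt_1)

text \<open>Both signs of a row are equally likely, so the imaginary parts cancel.\<close>

lemma fourier_step_pmf:
  "fourier h (step_pmf A) =
    of_real ((\<Sum>i\<in>UNIV. cos (2 * pi * (\<Sum>j\<in>UNIV. A $ i $ j * of_int (h j)))) / real CARD('n))"
  for A :: "real^'d^'n"
proof -
  let ?y = "\<lambda>i. 2 * pi * (\<Sum>j\<in>UNIV. A $ i $ j * of_int (h j))"
  have fin: "finite (set_pmf (step_pmf A))" by (simp add: step_pmf_def)
  have ch: "torus_char h (A $ i) = cis (- ?y i)" "torus_char h (- (A $ i)) = cis (?y i)" for i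
    by (simp_all add: torus_char_def sum_negf mult.commute)
  have "fourier h (step_pmf A) = (\<Sum>(i, s)\<in>UNIV. torus_char h (tmod (if s then A $ i else - (A $ i)))) / (2 * of_nat CARD('n))"
    unfolding fourier_conv_expectation[OF fin]
    unfolding step_pmf_def integral_map_pmf
    by (subst integral_measure_pmf[of UNIV])
      (simp_all add: case_prod_unfold scaleR_conv_of_real sum_divide_distrib field_simps)
  also have "(\<Sum>(i, s)\<in>UNIV. torus_char h (tmod (if s then A $ i else - (A $ i))))
      = (\<Sum>i\<in>UNIV. \<Sum>s\<in>UNIV. torus_char h (if s then A $ i else - (A $ i)))"
    by (simp add: torus_char_tmod sum.cartesian_product flip: UNIV_Times_UNIV)
  also have "\<dots> = (\<Sum>i\<in>UNIV. cis (?y i) + cis (- ?y i))"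
    by (simp add: UNIV_bool ch)
  also have "\<dots> = (\<Sum>i\<in>UNIV. 2 * of_real (cos (?y i)))"
    by (intro sum.cong) (auto simp: complex_eq_iff)
  finally show ?thesis by (simp flip: sum_distrib_left)
qed

text \<open>With z the distance from y to the nearest integer, cos (pi z) = 1 - 2 sin^2 (pi z / 2),
  and the sine is at least sqrt 2 z. Equality holds at integers and half-integers.\<close>

lemma abs_cos_pi_le:
  fixes y :: real
  shows "\<bar>cos (pi * y)\<bar> \<le> 1 - 4 * (y - of_int (round y))\<^sup>2"
proof -
  define z where "z = \<bar>y - of_int (round y)\<bar>"
  have z: "0 \<le> z" "z \<le> 1/2"
    using of_int_round_abs_le[of y] by (auto simp: z_def abs_minus_commute)
  have "cos (pi * y) = cos (pi * (y - of_int (round y)) + pi * of_int (round y))"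
    by (simp add: algebra_simps)
  also have "\<bar>\<dots>\<bar> = \<bar>cos (pi * (y - of_int (round y)))\<bar>"
    by (simp add: cos_add abs_mult cos_npi_int sin_npi_int)
  also have "\<dots> = \<bar>cos (pi * z)\<bar>"
    using cos_abs_real[of "pi * (y - of_int (round y))"] by (simp add: z_def abs_mult)
  also have "\<dots> = cos (pi * z)"
    using z by (intro abs_of_nonneg cos_ge_zero) (auto intro: order_trans[of _ 0])
  also have "\<dots> = 1 - 2 * (sin (pi * z / 2))\<^sup>2"
    using cos_double_sin[of "pi * z / 2"] by simp
  also have "\<dots> \<le> 1 - 2 * (sqrt 2 * z)\<^sup>2"
  proof -
    \<comment> \<open>concavity of the sine: its graph lies above the chord over \<open>[0, \<pi>/4]\<close>\<close>
    have "concave_on {0..pi/4} sin"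
    proof (rule f''_le0_imp_concave[where f'=cos and f''="\<lambda>x. - sin x"])
      show "- sin x \<le> 0" if "x \<in> {0..pi/4}" for x
        using that by (simp add: sin_ge_zero)
    qed (auto intro!: derivative_eq_intros)
    then have "(1 - 2 * z) * sin 0 + (2 * z) * sin (pi / 4) \<le> sin ((1 - 2 * z) *\<^sub>R 0 + (2 * z) *\<^sub>R (pi / 4))"
      using z concave_onD[of "{0..pi/4}" sin "2 * z" 0 "pi/4"] by simp
    then have "sqrt 2 * z \<le> sin (pi * z / 2)"
      by (simp add: sin_45 mult.commute)
    then show ?thesis using z by (simp add: power_mono)
  qed
  also have "\<dots> = 1 - 4 * (y - of_int (round y))\<^sup>2"
    by (simp add: power_mult_distrib z_def)
  finally show ?thesis .
qed

text \<open>Doubling sends both the integers and the half-integers to the integers; these are the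
  points where the cosine has absolute value \<open>1\<close>.\<close>

definition doubled_residue :: "real^'d^'n \<Rightarrow> ('d \<Rightarrow> int) \<Rightarrow> 'n \<Rightarrow> real" where
  "doubled_residue A h i = (let y = 2 * (\<Sum>j\<in>UNIV. A $ i $ j * of_int (h j)) in y - of_int (round y))"

text \<open>The cosine of 2 pi a is that of pi y with y = 2 a, which brings in the doubled residues;
  1 + x <= exp x then turns the k-th power into a Gaussian.\<close>

lemma norm_fourier_step_pmf_power:
  fixes A :: "real^'d^'n"
  shows "cmod (fourier h (step_pmf A)) ^ k \<le> exp (- (4 * real k / real CARD('n)) * (\<Sum>i\<in>UNIV. (doubled_residue A h i)\<^sup>2))"
proof -
  let ?n = "real CARD('n)"
  let ?w = "\<Sum>i\<in>UNIV. (doubled_residue A h i)\<^sup>2"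
  have "\<bar>cos (2 * pi * (\<Sum>j\<in>UNIV. A $ i $ j * of_int (h j)))\<bar> \<le> 1 - 4 * (doubled_residue A h i)\<^sup>2" for i
    using abs_cos_pi_le[of "2 * (\<Sum>j\<in>UNIV. A $ i $ j * of_int (h j))"]
    by (simp add: doubled_residue_def Let_def mult.assoc mult.left_commute)
  then have "(\<Sum>i\<in>UNIV. \<bar>cos (2 * pi * (\<Sum>j\<in>UNIV. A $ i $ j * of_int (h j)))\<bar>) \<le> (\<Sum>i\<in>(UNIV::'n set). 1 - 4 * (doubled_residue A h i)\<^sup>2)"
    by (intro sum_mono)
  also have "\<dots> = ?n - 4 * ?w" by (simp add: sum_subtractf sum_distrib_left)
  finally have "\<bar>\<Sum>i\<in>UNIV. cos (2 * pi * (\<Sum>j\<in>UNIV. A $ i $ j * of_int (h j)))\<bar> \<le> ?n - 4 * ?w"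
    by (rule order_trans[OF sum_abs])
  then have "cmod (fourier h (step_pmf A)) \<le> (?n - 4 * ?w) / ?n"
    unfolding fourier_step_pmf norm_of_real abs_divide by (simp add: divide_right_mono)
  also have "\<dots> = 1 + (- 4 / ?n * ?w)" by (simp add: field_simps)
  also have "\<dots> \<le> exp (- 4 / ?n * ?w)" by (rule exp_ge_add_one_self)
  finally have "cmod (fourier h (step_pmf A)) ^ k \<le> exp (- 4 / ?n * ?w) ^ k"
    by (intro power_mono) auto
  also have "\<dots> = exp (- (4 * real k / ?n) * ?w)"
    by (simp add: exp_of_nat_mult[symmetric] algebra_simps)
  finally show ?thesis .
qed

text \<open>The difference of two residues agrees modulo 1 with a coordinate of A applied to the
  nonzero integer vector 2 (h - h'). Taking h' = 0 bounds a single residue from below.\<close>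

lemma doubled_residue_separation:
  fixes A :: "real^'d^'n"
  assumes bad: "badly_approximable_with A C" and "h \<noteq> h'"
  shows "\<exists>i. C / (2 * of_int (int_norm (\<lambda>j. h j - h' j))) powr (real CARD('d) / real CARD('n))
    < \<bar>doubled_residue A h i - doubled_residue A h' i\<bar>"
proof -
  define g where "g j = h j - h' j" for j
  define v :: "real^'d" where "v = (\<chi> j. 2 * of_int (g j))"
  have "int_vec v" by (simp add: int_vec_def v_def)
  moreover have "v \<noteq> 0" using \<open>h \<noteq> h'\<close> by (auto simp: v_def g_def vec_eq_iff)
  moreover have "sup_norm v = 2 * of_int (int_norm g)"
  proof -
    have "sup_norm v = Max ((\<lambda>x. 2 * of_int x) ` range (\<lambda>j. \<bar>g j\<bar>))"
      by (simp add: sup_norm_def v_def image_image abs_mult)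
    also have "\<dots> = 2 * of_int (int_norm g)"
      using mono_Max_commute[of "\<lambda>x. 2 * real_of_int x" "range (\<lambda>j. \<bar>g j\<bar>)"]
      by (simp add: int_norm_def mono_def)
    finally show ?thesis .
  qed
  ultimately have "C / (2 * of_int (int_norm g)) powr (real CARD('d) / real CARD('n)) < dist_Zm (A *v v)"
    using bad unfolding badly_approximable_with_def by metis
  moreover obtain i where "dist_Zm (A *v v) = \<bar>(A *v v) $ i - of_int (round ((A *v v) $ i))\<bar>"
  proof -
    have "dist_Zm (A *v v) \<in> range (\<lambda>i. \<bar>(A *v v) $ i - of_int (round ((A *v v) $ i))\<bar>)"
      unfolding dist_Zm_def by (intro Max_in) auto
    then show ?thesis using that by auto
  qed
  moreover have "\<bar>(A *v v) $ i - of_int (round ((A *v v) $ i))\<bar> \<le> \<bar>doubled_residue A h i - doubled_residue A h' i\<bar>"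
  proof -
    define m where "m = round (2 * (\<Sum>j\<in>UNIV. A $ i $ j * of_int (h j)))
      - round (2 * (\<Sum>j\<in>UNIV. A $ i $ j * of_int (h' j)))"
    have "(A *v v) $ i = 2 * (\<Sum>j\<in>UNIV. A $ i $ j * of_int (h j)) - 2 * (\<Sum>j\<in>UNIV. A $ i $ j * of_int (h' j))"
      by (simp add: matrix_vector_mult_def v_def g_def sum_distrib_left algebra_simps sum_subtractf)
    then have "(A *v v) $ i - of_int m = doubled_residue A h i - doubled_residue A h' i"
      by (simp add: doubled_residue_def Let_def m_def)
    then show ?thesis using round_diff_minimal[of "(A *v v) $ i" m] by simp
  qed
  ultimately show ?thesis unfolding g_def by (intro exI[of _ i]) linarith
qed

section \<open>The exponential sum\<close>

text \<open>The exponent takes each value twice, at the mirror images m and -m - 1, which gives two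
  geometric series.\<close>

lemma sum_geometric_two_sided:
  fixes q :: real
  assumes "0 \<le> q" "q < 1"
  shows "(\<Sum>m\<in>{- int T - 1..int T}. q ^ nat (if 0 \<le> m then m else - m - 1)) \<le> 2 / (1 - q)"
proof -
  have geo: "(\<Sum>k<Suc T. q ^ k) \<le> 1 / (1 - q)"
    using assms by (subst sum_gp_strict) (auto intro!: divide_right_mono)
  have "{- int T - 1..int T} = {0..int T} \<union> {- int T - 1..-1}" by auto
  then have "(\<Sum>m\<in>{- int T - 1..int T}. q ^ nat (if 0 \<le> m then m else - m - 1))
      = (\<Sum>m\<in>{0..int T}. q ^ nat (if 0 \<le> m then m else - m - 1))
      + (\<Sum>m\<in>{- int T - 1..-1}. q ^ nat (if 0 \<le> m then m else - m - 1))"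
    by (simp only:) (rule sum.union_disjoint; auto)
  also have "(\<Sum>m\<in>{0..int T}. q ^ nat (if 0 \<le> m then m else - m - 1)) = (\<Sum>k<Suc T. q ^ k)"
    by (rule sum.reindex_bij_witness[where i=int and j=nat]) auto
  also have "(\<Sum>m\<in>{- int T - 1..-1}. q ^ nat (if 0 \<le> m then m else - m - 1)) = (\<Sum>k<Suc T. q ^ k)"
    by (rule sum.reindex_bij_witness[where i="\<lambda>k. - int k - 1" and j="\<lambda>m. nat (- m - 1)"]) auto
  finally show ?thesis using geo by simp
qed

text \<open>Each cell of the cubic lattice of mesh \<open>\<delta>\<close> contains at most one of the points,
  and the \<open>2 ^ n\<close> cells around the origin contain none.\<close>

lemma gaussian_sum_separated:
  fixes z :: "'b \<Rightarrow> 'n::finite \<Rightarrow> real"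
  assumes H: "finite H" and \<delta>: "0 < \<delta>" and \<beta>: "0 < \<beta>"
    and off: "\<And>h. h \<in> H \<Longrightarrow> \<exists>i. \<delta> < \<bar>z h i\<bar>"
    and sep: "\<And>h h'. h \<in> H \<Longrightarrow> h' \<in> H \<Longrightarrow> h \<noteq> h' \<Longrightarrow> \<exists>i. \<delta> < \<bar>z h i - z h' i\<bar>"
  defines "q \<equiv> exp (- (\<beta> * \<delta>\<^sup>2))"
  shows "(\<Sum>h\<in>H. exp (- \<beta> * (\<Sum>i\<in>UNIV. (z h i)\<^sup>2))) \<le> (2 / (1 - q)) ^ CARD('n) - 2 ^ CARD('n)"
proof -
  \<comment> \<open>\<open>\<mu> m\<close> counts the whole cells between cell m and the origin; the
    cells 0 and -1 both touch it.\<close>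
  define \<mu> :: "int \<Rightarrow> nat" where "\<mu> m = nat (if 0 \<le> m then m else - m - 1)" for m
  define c where "c h i = \<lfloor>z h i / \<delta>\<rfloor>" for h i
  have q: "0 \<le> q" "q < 1" using \<delta> \<beta> by (auto simp: q_def)
  have cell: "of_int (c h i) * \<delta> \<le> z h i \<and> z h i < (of_int (c h i) + 1) * \<delta>" for h i
    unfolding c_def using \<delta> floor_divide_lower floor_divide_upper by blast
  have inj: "inj_on c H"
  proof (rule inj_onI, rule ccontr)
    fix h h' assume h: "h \<in> H" "h' \<in> H" "c h = c h'" "h \<noteq> h'"
    then obtain i where "\<delta> < \<bar>z h i - z h' i\<bar>" using sep by blast
    then show False using cell[of h i] cell[of h' i] h(3) by (auto simp: algebra_simps)
  qed
  have lower: "real (\<mu> (c h i)) * \<delta> \<le> \<bar>z h i\<bar>" for h i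
  proof (cases "0 \<le> c h i")
    case True
    then have "real (\<mu> (c h i)) = of_int (c h i)" by (simp add: \<mu>_def)
    then have "real (\<mu> (c h i)) * \<delta> = of_int (c h i) * \<delta>" by simp
    then show ?thesis using cell[of h i] by linarith
  next
    case False
    then have "real (\<mu> (c h i)) = - (of_int (c h i) + 1)" by (simp add: \<mu>_def)
    then have "real (\<mu> (c h i)) * \<delta> = - ((of_int (c h i) + 1) * \<delta>)" by (simp only: mult_minus_left)
    then show ?thesis using cell[of h i] by linarith
  qed
  define T where "T = nat (Max (insert 0 ((\<lambda>(h, i). \<bar>c h i\<bar>) ` (H \<times> UNIV))))"
  have T: "\<bar>c h i\<bar> \<le> int T" if "h \<in> H" for h i
  proof -
    have "\<bar>c h i\<bar> \<le> Max (insert 0 ((\<lambda>(h, i). \<bar>c h i\<bar>) ` (H \<times> UNIV)))"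
      using H that by (intro Max_ge) force+
    then show ?thesis unfolding T_def by linarith
  qed
  define B where "B = (UNIV :: 'n set) \<rightarrow>\<^sub>E {- int T - 1..int T}"
  define B0 where "B0 = (UNIV :: 'n set) \<rightarrow>\<^sub>E {-1, 0::int}"
  have finB: "finite B" unfolding B_def by (intro finite_PiE) auto
  have B0: "B0 \<subseteq> B" unfolding B_def B0_def by (intro PiE_mono) auto
  have "(\<Sum>h\<in>H. exp (- \<beta> * (\<Sum>i\<in>UNIV. (z h i)\<^sup>2))) \<le> (\<Sum>h\<in>H. \<Prod>i\<in>UNIV. q ^ \<mu> (c h i))"
  proof (rule sum_mono)
    fix h
    have "exp (- \<beta> * (\<Sum>i\<in>UNIV. (z h i)\<^sup>2)) = (\<Prod>i\<in>UNIV. exp (- \<beta> * (z h i)\<^sup>2))"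
      by (simp add: sum_distrib_left sum_negf flip: exp_sum)
    also have "\<dots> \<le> (\<Prod>i\<in>UNIV. q ^ \<mu> (c h i))"
    proof (rule prod_mono, intro conjI)
      fix i
      \<comment> \<open>A natural number is at most its square, so each Gaussian factor is dominated
        by a geometric term.\<close>
      have "real (\<mu> (c h i)) * \<delta>\<^sup>2 \<le> (real (\<mu> (c h i)))\<^sup>2 * \<delta>\<^sup>2"
        by (intro mult_right_mono) (simp_all add: power2_eq_square flip: of_nat_mult)
      also have "\<dots> \<le> (z h i)\<^sup>2"
        using power_mono[OF lower[of h i], of 2] \<delta> by (simp add: power_mult_distrib)
      finally have "\<beta> * (real (\<mu> (c h i)) * \<delta>\<^sup>2) \<le> \<beta> * (z h i)\<^sup>2" using \<beta> by (intro mult_left_mono) auto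
      moreover have "q ^ \<mu> (c h i) = exp (- (\<beta> * (real (\<mu> (c h i)) * \<delta>\<^sup>2)))"
        unfolding q_def exp_of_nat_mult[symmetric] by (simp add: algebra_simps)
      ultimately show "exp (- \<beta> * (z h i)\<^sup>2) \<le> q ^ \<mu> (c h i)" by simp
    qed simp
    finally show "exp (- \<beta> * (\<Sum>i\<in>UNIV. (z h i)\<^sup>2)) \<le> (\<Prod>i\<in>UNIV. q ^ \<mu> (c h i))" .
  qed
  also have "\<dots> = (\<Sum>m\<in>c ` H. \<Prod>i\<in>UNIV. q ^ \<mu> (m i))"
    using inj by (simp add: sum.reindex)
  also have "\<dots> \<le> (\<Sum>m\<in>B - B0. \<Prod>i\<in>UNIV. q ^ \<mu> (m i))"
  proof (rule sum_mono2)
    show "c ` H \<subseteq> B - B0"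
    proof
      fix m assume "m \<in> c ` H"
      then obtain h where h: "h \<in> H" "m = c h" by auto
      have "- int T - 1 \<le> c h i \<and> c h i \<le> int T" for i using T[OF h(1), of i] by linarith
      then have "m \<in> B" by (auto simp: B_def h(2))
      moreover have "m \<notin> B0"
      proof
        assume "m \<in> B0"
        then have "c h i \<in> {-1, 0}" for i by (auto simp: B0_def h(2) PiE_def Pi_def)
        then have "- \<delta> \<le> z h i \<and> z h i \<le> \<delta>" for i
          using cell[of h i] \<delta> by (cases "c h i = 0") force+
        then have "\<bar>z h i\<bar> \<le> \<delta>" for i by (simp add: abs_le_iff minus_le_iff)
        then show False using off[OF h(1)] by (meson not_le)
      qed
      ultimately show "m \<in> B - B0" by simp
    qed
  qed (use finB q in \<open>auto intro!: prod_nonneg\<close>)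
  also have "\<dots> = (\<Sum>m\<in>B. \<Prod>i\<in>UNIV. q ^ \<mu> (m i)) - (\<Sum>m\<in>B0. \<Prod>i\<in>UNIV. q ^ \<mu> (m i))"
    by (rule sum_diff[OF finB B0])
  also have "(\<Sum>m\<in>B. \<Prod>i\<in>UNIV. q ^ \<mu> (m i)) = (\<Sum>m\<in>{- int T - 1..int T}. q ^ \<mu> m) ^ CARD('n)"
    unfolding B_def using prod_sum_PiE[of "UNIV::'n set" "\<lambda>_. {- int T - 1..int T}" "\<lambda>_ m. q ^ \<mu> m"]
    by simp
  also have "(\<Sum>m\<in>B0. \<Prod>i\<in>UNIV. q ^ \<mu> (m i)) = 2 ^ CARD('n)"
    unfolding B0_def using prod_sum_PiE[of "UNIV::'n set" "\<lambda>_. {-1, 0}" "\<lambda>_ m. q ^ \<mu> m"]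
    by (simp add: \<mu>_def)
  also have "(\<Sum>m\<in>{- int T - 1..int T}. q ^ \<mu> m) ^ CARD('n) \<le> (2 / (1 - q)) ^ CARD('n)"
    using sum_geometric_two_sided[OF q, of T] q by (intro power_mono) (auto simp: \<mu>_def intro!: sum_nonneg)
  finally show ?thesis by simp
qed

text \<open>For q = exp (-n), Bernoulli gives (1 - q)^n >= 1 - n q >= 1/2, so the bracket is at most
  2^n, and exp (-n) 2^n = (2/e)^n <= 1. The prefactor exp (-n) is the one from
  \<open>fourier_decay\<close>.\<close>

lemma packing_constant:
  assumes "1 \<le> n"
  shows "exp (- real n) * ((2 / (1 - exp (- real n))) ^ n - 2 ^ n) \<le> 1"
proof -
  define q where "q = exp (- real n)"
  have q: "0 < q" "q < 1" using assms by (auto simp: q_def)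
  \<comment> \<open>The quadratic Taylor bound 1 + n + n^2/2 exceeds 2 n by ((n - 1)^2 + 1) /
    2.\<close>
  have "2 * real n \<le> exp (real n)"
    using exp_lower_Taylor_quadratic[of "real n"] zero_le_power2[of "real n - 1"]
    by (simp add: power2_diff)
  then have "real n * q \<le> 1 / 2" by (simp add: q_def exp_minus field_simps)
  moreover have "1 + real n * (- q) \<le> (1 + - q) ^ n"
    using q by (intro Bernoulli_inequality) auto
  ultimately have half: "1 / 2 \<le> (1 - q) ^ n" by simp
  then have "1 / (1 - q) ^ n \<le> 2"
    using q by (simp add: field_simps)
  then have "2 ^ n * (1 / (1 - q) ^ n - 1) \<le> 2 ^ n * (1::real)" by (intro mult_left_mono) auto
  then have "q * ((2 / (1 - q)) ^ n - 2 ^ n) \<le> q * 2 ^ n"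
    using q by (intro mult_left_mono) (auto simp: power_divide algebra_simps)
  also have "q * 2 ^ n = (2 / exp 1 :: real) ^ n"
    by (simp add: q_def exp_minus power_divide inverse_eq_divide flip: exp_of_nat_mult)
  also have "\<dots> \<le> 1"
    using exp_ge_add_one_self[of "1::real"] by (intro power_le_one) auto
  finally show ?thesis by (simp add: q_def)
qed

text \<open>The scale \<delta> is the distance that bad approximability grants at norm Y, and 2 k
  \<delta>^2 / n = n. A frequency of norm N has a residue above \<delta> (2 N / Y)^(-d/n), so half
  of the Gaussian is at most exp (-n) (2 N / Y)^2; as 4 N <= Y, division by N leaves at most exp
  (-n) / Y.\<close>

lemma fourier_decay:
  fixes A :: "real^'d^'n" and C :: real
  assumes bad: "badly_approximable_with A C" and k: "1 \<le> k" and h: "h \<noteq> (\<lambda>_. 0)"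
  defines "d \<equiv> real CARD('d)" and "n \<equiv> real CARD('n)"
  defines "Y \<equiv> (C * sqrt (2 * real k) / n) powr (n / d)"
  assumes N: "4 * of_int (int_norm h) \<le> Y"
  shows "exp (- (2 * real k / n) * (\<Sum>i\<in>UNIV. (doubled_residue A h i)\<^sup>2)) / of_int (int_norm h) \<le> exp (- n) / Y"
proof -
  define N where "N = real_of_int (int_norm h)"
  define t where "t = 2 * N / Y"
  define \<delta> where "\<delta> = n / sqrt (2 * real k)"
  have C: "0 < C" using bad by (simp add: badly_approximable_with_def)
  have pos: "0 < d" "1 \<le> d" "0 < n" "0 < \<delta>" "0 < Y"
    using k C by (auto simp: d_def n_def \<delta>_def Y_def)
  have N1: "1 \<le> N" unfolding N_def using int_norm_pos[OF h] by simp
  have t: "0 < t" "t \<le> 1" using N N1 pos by (auto simp: t_def N_def field_simps)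
  have Yp: "Y powr (d / n) = C / \<delta>"
    using pos C k by (simp add: Y_def powr_powr \<delta>_def)
  have "C / (2 * N) powr (d / n) = C / (t powr (d / n) * Y powr (d / n))"
    using pos t by (simp add: t_def flip: powr_mult)
  also have "\<dots> = \<delta> * t powr (- (d / n))"
    using C pos by (simp add: Yp powr_minus field_simps)
  finally have eq: "C / (2 * N) powr (d / n) = \<delta> * t powr (- (d / n))" .
  have "doubled_residue A (\<lambda>_. 0) i = 0" for i by (simp add: doubled_residue_def)
  then obtain i where i: "\<delta> * t powr (- (d / n)) < \<bar>doubled_residue A h i\<bar>"
    using doubled_residue_separation[OF bad h] eq by (auto simp: N_def d_def n_def)
  \<comment> \<open>\<open>exp x \<ge> 1 + x\<close> turns the exponent into a power of \<open>t\<close> uniformly in \<open>n\<close>\<close>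
  have "1 + 2 * d / n * ln (1 / t) \<le> exp (2 * d / n * ln (1 / t))"
    by (rule exp_ge_add_one_self)
  also have "\<dots> = (t powr (- (d / n)))\<^sup>2"
    using t by (simp add: powr_def ln_div power2_eq_square flip: exp_add)
  finally have "\<delta>\<^sup>2 * (1 + 2 * d / n * ln (1 / t)) \<le> \<delta>\<^sup>2 * (t powr (- (d / n)))\<^sup>2"
    by (intro mult_left_mono) auto
  also have "\<dots> \<le> (doubled_residue A h i)\<^sup>2"
    using i pos power_mono[of "\<delta> * t powr (- (d / n))" "\<bar>doubled_residue A h i\<bar>" 2] by (simp add: power_mult_distrib)
  also have "\<dots> \<le> (\<Sum>i\<in>UNIV. (doubled_residue A h i)\<^sup>2)"
    by (intro member_le_sum) auto
  finally have "2 * real k / n * (\<delta>\<^sup>2 * (1 + 2 * d / n * ln (1 / t))) \<le> 2 * real k / n * (\<Sum>i\<in>UNIV. (doubled_residue A h i)\<^sup>2)"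
    using pos by (intro mult_left_mono) auto
  moreover have "2 * real k / n * (\<delta>\<^sup>2 * (1 + 2 * d / n * ln (1 / t))) = n + 2 * d * ln (1 / t)"
    using pos k by (simp add: \<delta>_def power_divide field_simps power2_eq_square)
  ultimately have "exp (- (2 * real k / n) * (\<Sum>i\<in>UNIV. (doubled_residue A h i)\<^sup>2)) \<le> exp (- n + 2 * d * ln t)"
    using t by (simp add: ln_div)
  also have "\<dots> = exp (- n) * t powr (2 * d)"
    using t by (simp add: powr_def flip: exp_add)
  also have "\<dots> \<le> exp (- n) * t powr 2"
    using t pos by (intro mult_left_mono powr_mono') auto
  also have "\<dots> = exp (- n) * t\<^sup>2"
    using t by (simp flip: powr_numeral)
  finally have "exp (- (2 * real k / n) * (\<Sum>i\<in>UNIV. (doubled_residue A h i)\<^sup>2)) / N \<le> exp (- n) * t\<^sup>2 / N"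
    using N1 by (intro divide_right_mono) auto
  also have "\<dots> = exp (- n) * (4 * N / Y) / Y"
    using N1 by (simp add: t_def power2_eq_square)
  also have "\<dots> \<le> exp (- n) * 1 / Y"
    using pos N by (intro divide_right_mono mult_left_mono) (auto simp: N_def)
  finally show ?thesis by (simp add: N_def)
qed

lemma walk_exponential_sum:
  fixes A :: "real^'d^'n" and C :: real and L :: nat
  assumes bad: "badly_approximable_with A C" and k: "1 \<le> k"
  defines "d \<equiv> real CARD('d)" and "n \<equiv> real CARD('n)"
  defines "Y \<equiv> (C * sqrt (2 * real k) / n) powr (n / d)"
  assumes L: "4 * real L \<le> Y"
  shows "(\<Sum>h\<in>(UNIV \<rightarrow>\<^sub>E {- int L..int L}) - {\<lambda>_. 0}. cmod (fourier h (conv_power (step_pmf A) k)) / (pi * of_int (int_norm h)))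
    \<le> 1 / Y"
proof -
  define H where "H = (UNIV \<rightarrow>\<^sub>E {- int L..int L}) - {\<lambda>_::'d. 0::int}"
  define \<delta> where "\<delta> = n / sqrt (2 * real k)"
  define \<beta> where "\<beta> = 2 * real k / n"
  have C: "0 < C" using bad by (simp add: badly_approximable_with_def)
  have pos: "0 < d" "0 < n" "0 < \<delta>" "0 < Y" "0 < \<beta>"
    using k C by (auto simp: d_def n_def \<delta>_def Y_def \<beta>_def)
  have "finite (UNIV \<rightarrow>\<^sub>E {- int L..int L} :: ('d \<Rightarrow> int) set)" by (intro finite_PiE) auto
  then have finH: "finite H" by (simp add: H_def)
  have bounded: "\<bar>h i\<bar> \<le> int L" if "h \<in> H \<or> h = (\<lambda>_. 0)" for h i
    using that by (auto simp: H_def PiE_def Pi_def abs_le_iff minus_le_iff)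
  have sep: "\<exists>i. \<delta> < \<bar>doubled_residue A h i - doubled_residue A h' i\<bar>"
    if hh: "h \<in> H \<or> h = (\<lambda>_. 0)" "h' \<in> H \<or> h' = (\<lambda>_. 0)" "h \<noteq> h'" for h h'
  proof -
    define g where "g j = h j - h' j" for j
    obtain j where "\<bar>g j\<bar> = int_norm g" by (rule int_norm_attained)
    \<comment> \<open>Differences of frequencies in the cube have norm at most 2 L, and doubling
      brings this to 4 L: hence the condition 4 L <= Y.\<close>
    then have "int_norm g \<le> 2 * int L"
      using bounded[OF hh(1), of j] bounded[OF hh(2), of j] by (simp add: g_def)
    then have le: "2 * real_of_int (int_norm g) \<le> Y" using L by linarith
    have "g \<noteq> (\<lambda>_. 0)" using hh(3) by (auto simp: g_def fun_eq_iff)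
    then have "1 \<le> int_norm g" by (rule int_norm_pos)
    then have ge: "0 < 2 * real_of_int (int_norm g)" by simp
    have "\<delta> = C / Y powr (d / n)"
      using pos C k by (simp add: Y_def powr_powr \<delta>_def)
    also have "\<dots> \<le> C / (2 * real_of_int (int_norm g)) powr (d / n)"
      using ge le C pos by (intro divide_left_mono powr_mono2) auto
    finally show ?thesis
      using doubled_residue_separation[OF bad hh(3)] unfolding g_def d_def n_def by (meson le_less_trans)
  qed
  have "(\<Sum>h\<in>H. cmod (fourier h (conv_power (step_pmf A) k)) / (pi * of_int (int_norm h)))
      \<le> (\<Sum>h\<in>H. exp (- n) / Y * exp (- \<beta> * (\<Sum>i\<in>UNIV. (doubled_residue A h i)\<^sup>2)))"
  proof (rule sum_mono)
    fix h assume h: "h \<in> H"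
    let ?E = "exp (- \<beta> * (\<Sum>i\<in>UNIV. (doubled_residue A h i)\<^sup>2))"
    have h0: "h \<noteq> (\<lambda>_. 0)" using h by (simp add: H_def)
    obtain j where "\<bar>h j\<bar> = int_norm h" by (rule int_norm_attained)
    then have "int_norm h \<le> int L" using bounded[of h j] h by simp
    then have "4 * of_int (int_norm h) \<le> Y" using L by linarith
    then have decay: "?E / of_int (int_norm h) \<le> exp (- n) / Y"
      using fourier_decay[OF bad k h0] by (simp add: \<beta>_def n_def d_def Y_def)
    have N: "0 < real_of_int (int_norm h)" using int_norm_pos[OF h0] by simp
    have "finite (set_pmf (step_pmf A))" by (simp add: step_pmf_def)
    then have "cmod (fourier h (conv_power (step_pmf A) k)) \<le> exp (- (4 * real k / n) * (\<Sum>i\<in>UNIV. (doubled_residue A h i)\<^sup>2))"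
      using norm_fourier_step_pmf_power[of h A k] by (simp add: fourier_conv_power norm_power n_def)
    \<comment> \<open>Each \<open>?E\<close> has half of the exponent: one copy is spent on the
      weight, the other is left for the packing sum.\<close>
    also have "\<dots> = ?E * ?E" by (simp add: \<beta>_def flip: exp_add)
    finally have "cmod (fourier h (conv_power (step_pmf A) k)) / (pi * of_int (int_norm h))
        \<le> (?E * ?E) / (1 * of_int (int_norm h))"
      using N pi_ge_two by (intro frac_le mult_right_mono) auto
    also have "\<dots> = (?E / of_int (int_norm h)) * ?E" by simp
    also have "\<dots> \<le> exp (- n) / Y * ?E" by (intro mult_right_mono decay) auto
    finally show "cmod (fourier h (conv_power (step_pmf A) k)) / (pi * of_int (int_norm h)) \<le> exp (- n) / Y * ?E" .
  qed
  also have "\<dots> = exp (- n) / Y * (\<Sum>h\<in>H. exp (- \<beta> * (\<Sum>i\<in>UNIV. (doubled_residue A h i)\<^sup>2)))"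
    by (simp only: sum_distrib_left)
  also have "\<dots> \<le> exp (- n) / Y * ((2 / (1 - exp (- (\<beta> * \<delta>\<^sup>2)))) ^ CARD('n) - 2 ^ CARD('n))"
  proof (intro mult_left_mono gaussian_sum_separated finH pos)
    show "\<exists>i. \<delta> < \<bar>doubled_residue A h i\<bar>" if "h \<in> H" for h
      using sep[of h "\<lambda>_. 0"] that by (auto simp: H_def doubled_residue_def)
    show "\<exists>i. \<delta> < \<bar>doubled_residue A h i - doubled_residue A h' i\<bar>" if "h \<in> H" "h' \<in> H" "h \<noteq> h'" for h h'
      using sep that by blast
  qed (use pos in auto)
  \<comment> \<open>At this scale the ratio of the geometric series is exp (-n), as in
    \<open>packing_constant\<close>.\<close>
  also have "\<beta> * \<delta>\<^sup>2 = n"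
    using pos k by (simp add: \<beta>_def \<delta>_def power_divide field_simps power2_eq_square)
  also have "exp (- n) / Y * ((2 / (1 - exp (- n))) ^ CARD('n) - 2 ^ CARD('n)) \<le> 1 / Y"
    using packing_constant[of "CARD('n)"] pos by (simp add: n_def divide_right_mono Suc_leI)
  finally show ?thesis unfolding H_def .
qed

section \<open>The discrepancy bound\<close>

lemma cos_quartic_bound:
  fixes x :: real
  assumes "0 \<le> x"
  shows "cos x \<le> 1 - x\<^sup>2 / 2 + x ^ 4 / 24"
proof (cases "x = 0")
  case False
  obtain t where t: "cos x = (\<Sum>m<4. cos_coeff m * x ^ m) + cos (t + 1/2 * real 4 * pi) / fact 4 * x ^ 4"
    using Maclaurin_cos_expansion2[of x 4] False assms by auto
  have *: "{..<4::nat} = {0, 1, 2, 3}" by auto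
  have "(\<Sum>m<4. cos_coeff m * x ^ m) = 1 - x\<^sup>2 / 2"
    unfolding * by (simp add: cos_coeff_def)
  moreover have "cos (t + 1/2 * real 4 * pi) / fact 4 * x ^ 4 \<le> 1 / 24 * x ^ 4"
    by (intro mult_right_mono) (simp_all add: fact_numeral)
  ultimately show ?thesis using t by simp
qed simp

text \<open>For \<theta> = pi / (L + 2) and 2 pi \<epsilon> = 17/5 \<theta> this is the tail
  estimate with \<tau> = 1/10. After multiplication by 10 the quadratic coefficients are 5 and 5.78,
  and the range of \<theta> keeps the quartic correction below the gap.\<close>

lemma one_minus_cos_ratio:
  fixes \<theta> :: real
  assumes "0 \<le> \<theta>" "\<theta> \<le> pi / 9"
  shows "1 - cos \<theta> \<le> 1 / 10 * (1 - cos (17 / 5 * \<theta>))"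
proof -
  \<comment> \<open>7/20 is a rational number just above pi / 9.\<close>
  have "\<theta> \<le> 7 / 20" using assms pi_less_4 pi_approx by simp
  then have "\<theta>\<^sup>2 \<le> (7 / 20)\<^sup>2" using assms by (intro power_mono) auto
  then have "\<theta>\<^sup>2 * \<theta>\<^sup>2 \<le> 49 / 400 * \<theta>\<^sup>2" by (intro mult_right_mono) (auto simp: power2_eq_square)
  then have 4: "\<theta> ^ 4 \<le> 49 / 400 * \<theta>\<^sup>2" by (simp flip: power_add)
  have "1 - cos \<theta> = 2 * (sin (\<theta> / 2))\<^sup>2" using cos_double_sin[of "\<theta> / 2"] by simp
  also have "\<dots> \<le> 2 * (\<theta> / 2)\<^sup>2"
    using abs_sin_x_le_abs_x[of "\<theta> / 2"] unfolding abs_le_square_iff by simp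
  finally have "10 * (1 - cos \<theta>) \<le> 5 * \<theta>\<^sup>2" by (simp add: power_divide)
  moreover have "cos (17 / 5 * \<theta>) \<le> 1 - (17 / 5 * \<theta>)\<^sup>2 / 2 + (17 / 5 * \<theta>) ^ 4 / 24"
    using assms by (intro cos_quartic_bound) auto
  moreover have "(17 / 5 * \<theta>)\<^sup>2 / 2 = 289 / 50 * \<theta>\<^sup>2" "(17 / 5 * \<theta>) ^ 4 / 24 = 83521 / 15000 * \<theta> ^ 4"
    unfolding power_mult_distrib by (simp_all add: power_divide)
  ultimately have "10 * (1 - cos \<theta>) \<le> 5 * \<theta>\<^sup>2"
      "cos (17 / 5 * \<theta>) \<le> 1 - 289 / 50 * \<theta>\<^sup>2 + 83521 / 15000 * \<theta> ^ 4"
    by simp_all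
  moreover have "p \<le> 1 / 10 * (1 - r)"
    if "10 * p \<le> 5 * t" "r \<le> 1 - 289 / 50 * t + 83521 / 15000 * w" "w \<le> 49 / 400 * t" "0 \<le> t"
    for p r t w :: real
    using that by simp
  ultimately show ?thesis using 4 zero_le_power2[of \<theta>] by blast
qed

text \<open>For e = 34/5 / Y the map is y -> 5/4 (y + 68/5 / Y), with fixed point -68 / Y. The start
  1 / Y is 69 / Y away from it, and each step multiplies this distance by 5/4.\<close>

lemma affine_iteration_bound:
  fixes b e Y :: real
  assumes "b \<le> 1 / Y" and "e \<le> 34 / 5 / Y"
  shows "((\<lambda>y. (y + 2 * e) / (1 - 2 * (1 / 10))) ^^ m) b \<le> (69 * (5 / 4) ^ m - 68) / Y"
proof (induction m)
  case 0
  then show ?case using assms by simp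
next
  case (Suc m)
  have "(((\<lambda>y. (y + 2 * e) / (1 - 2 * (1 / 10))) ^^ Suc m) b)
      = 5 / 4 * (((\<lambda>y. (y + 2 * e) / (1 - 2 * (1 / 10))) ^^ m) b + 2 * e)"
    by simp
  also have "\<dots> \<le> 5 / 4 * ((69 * (5 / 4) ^ m - 68) / Y + 2 * (34 / 5 / Y))"
    using Suc assms by (intro mult_left_mono add_mono) auto
  also have "\<dots> = (69 * (5 / 4) ^ Suc m - 68) / Y"
    by (simp add: diff_divide_distrib)
  finally show ?case .
qed

text \<open>From d = 7 on the term -68 is dropped and the growth rates 5/4 < 3/2 decide. The smaller
  cases are checked singly; d = 3 and d = 4 are nearly tight.\<close>

lemma numeric_bound: "1 \<le> d \<Longrightarrow> 69 * (5 / 4) ^ d - 68 \<le> 20 * (3 / 2 :: real) ^ d"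
proof -
  assume d: "1 \<le> d"
  consider "d = 1" | "d = 2" | "d = 3" | "d = 4" | "d = 5" | "d = 6" | "7 \<le> d" using d by linarith
  then show ?thesis
  proof cases
    case 7
    then have "69 * (5 / 4) ^ d \<le> 20 * (3 / 2 :: real) ^ d"
    proof (induction d rule: dec_induct)
      case base
      show ?case by (simp add: power_divide)
    next
      case (step m)
      have "69 * (5 / 4) ^ Suc m \<le> 5 / 4 * (20 * (3 / 2 :: real) ^ m)" using step.IH by simp
      also have "\<dots> \<le> 20 * (3 / 2) ^ Suc m" by simp
      finally show ?case .
    qed
    then show ?thesis by simp
  qed (simp_all add: power_divide)
qed

text \<open>For 0 <= y < 1 and 0 <= c <= 1 the number c - y lies in (-1, 1], so its ceiling is the
  indicator of y < c. Differences of ceilings are thus indicators of the half-open sides.\<close>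

lemma prob_torus_box:
  fixes P :: "(real^'d) pmf"
  assumes fin: "finite (set_pmf P)" and cube: "\<And>x i. x \<in> set_pmf P \<Longrightarrow> 0 \<le> x $ i \<and> x $ i < 1"
    and ab: "is_box_params a b"
  shows "measure_pmf.prob P (torus_box a b)
    = (\<Sum>x\<in>set_pmf P. pmf P x * (\<Prod>i\<in>UNIV. of_int \<lceil>b $ i - x $ i\<rceil> - of_int \<lceil>a $ i - x $ i\<rceil>))"
proof -
  have ceil: "of_int \<lceil>c - y\<rceil> = (of_bool (y < c) :: real)" if "0 \<le> c" "c \<le> 1" "0 \<le> y" "y < 1" for c y :: real
  proof (cases "y < c")
    case True
    then have "\<lceil>c - y\<rceil> = 1" using that by (intro ceiling_unique) auto
    then show ?thesis using True by simp
  next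
    case False
    then have "\<lceil>c - y\<rceil> = 0" using that by (intro ceiling_unique) auto
    then show ?thesis using False by simp
  qed
  have fac: "(\<Prod>i\<in>UNIV. of_int \<lceil>b $ i - x $ i\<rceil> - of_int \<lceil>a $ i - x $ i\<rceil>) = (of_bool (x \<in> torus_box a b) :: real)"
    if x: "x \<in> set_pmf P" for x
  proof -
    have one: "of_int \<lceil>b $ i - x $ i\<rceil> - of_int \<lceil>a $ i - x $ i\<rceil> = (of_bool (a $ i \<le> x $ i \<and> x $ i < b $ i) :: real)" for i
    proof -
      have "0 \<le> a $ i" "a $ i \<le> b $ i" "b $ i \<le> 1" using ab by (auto simp: is_box_params_def)
      then show ?thesis using cube[OF x, of i] by (simp add: ceil)
    qed
    show ?thesis
      unfolding one torus_box_def by (cases "\<forall>i. a $ i \<le> x $ i \<and> x $ i < b $ i") auto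
  qed
  have "measure_pmf.prob P (torus_box a b) = measure_pmf.prob P (torus_box a b \<inter> set_pmf P)"
    by (simp add: measure_Int_set_pmf)
  also have "\<dots> = (\<Sum>x\<in>torus_box a b \<inter> set_pmf P. pmf P x)"
    using fin by (intro measure_measure_pmf_finite) auto
  also have "\<dots> = (\<Sum>x\<in>set_pmf P. pmf P x * of_bool (x \<in> torus_box a b))"
    using fin by (intro sum.mono_neutral_cong_left) auto
  finally show ?thesis using fac by (simp cong: sum.cong)
qed

theorem theorem2:
  fixes A :: "real^'d^'n" and C :: real and k :: nat
  assumes "badly_approximable_with A C"
    and "k \<ge> 1"
  shows "discrepancy (conv_power (step_pmf A) k)
     \<le> (3/2) ^ CARD('d) * 20 * (real CARD('n) / (C * sqrt 2)) powr (real CARD('n) / real CARD('d))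
        * real k powr (- (real CARD('n) / (2 * real CARD('d))))"
proof -
  define d n where "d = real CARD('d)" and "n = real CARD('n)"
  define Y where "Y = (C * sqrt (2 * real k) / n) powr (n / d)"
  define P where "P = conv_power (step_pmf A) k"
  have C: "0 < C" using assms by (simp add: badly_approximable_with_def)
  have pos: "0 < d" "0 < n" "0 < Y" using C assms(2) by (auto simp: d_def n_def Y_def)
  have "(n / (C * sqrt 2)) powr (n / d) * real k powr (- (n / (2 * d))) = 1 / Y"
  proof -
    have "real k powr (- (n / (2 * d))) = (1 / sqrt (real k)) powr (n / d)"
      using assms(2) by (simp add: powr_half_sqrt[symmetric] powr_powr powr_divide powr_minus_divide)
    then have "(n / (C * sqrt 2)) powr (n / d) * real k powr (- (n / (2 * d)))
        = (n / (C * sqrt 2) * (1 / sqrt (real k))) powr (n / d)"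
      using C pos by (simp flip: powr_mult)
    also have "n / (C * sqrt 2) * (1 / sqrt (real k)) = 1 / (C * sqrt (2 * real k) / n)"
      by (simp add: real_sqrt_mult)
    also have "\<dots> powr (n / d) = 1 / Y"
      using C pos by (simp add: Y_def powr_divide)
    finally show ?thesis .
  qed
  then have rhs: "(3/2) ^ CARD('d) * 20 * (n / (C * sqrt 2)) powr (n / d) * real k powr (- (n / (2 * d)))
      = 20 * (3/2) ^ CARD('d) / Y"
    by (simp only: mult.assoc) (simp add: mult.commute)
  have fin: "finite (set_pmf P)"
    unfolding P_def by (intro finite_conv_power) (simp add: step_pmf_def)
  have box: "0 \<le> b $ i - a $ i \<and> b $ i - a $ i \<le> 1" if "is_box_params a b" for a b :: "real^'d" and i
  proof -
    have "0 \<le> a $ i" "a $ i \<le> b $ i" "b $ i \<le> 1" using that by (auto simp: is_box_params_def)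
    then show ?thesis by simp
  qed
  have "\<bar>measure_pmf.prob P (torus_box a b) - haar_box a b\<bar> \<le> 20 * (3/2) ^ CARD('d) / Y"
    if ab: "is_box_params a b" for a b
  proof (cases "Y \<le> 20 * (3/2) ^ CARD('d)")
    \<comment> \<open>The difference of two numbers in [0, 1] is at most 1, which settles small
      Y.\<close>
    case True
    have "0 \<le> haar_box a b" "haar_box a b \<le> 1"
      unfolding haar_box_def using box[OF ab]
      by (auto intro!: prod_nonneg prod_le_1)
    moreover have "0 \<le> measure_pmf.prob P (torus_box a b)" "measure_pmf.prob P (torus_box a b) \<le> 1"
      by auto
    moreover have "1 \<le> 20 * (3/2) ^ CARD('d) / Y" using True pos by simp
    ultimately show ?thesis by linarith
  next
    case False
    have "(3/2) ^ 1 \<le> (3/2 :: real) ^ CARD('d)" by (intro power_increasing) (auto simp: Suc_leI)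
    then have Y: "30 \<le> Y" using False by simp
    \<comment> \<open>The largest degree that \<open>walk_exponential_sum\<close> admits; Y >= 30
      makes it at least 7, hence pi / (L + 2) <= pi / 9.\<close>
    define L where "L = nat \<lfloor>Y / 4\<rfloor>"
    have L: "4 * real L \<le> Y" "Y < 4 * (real L + 1)" using Y by (auto simp: L_def) linarith+
    then have "real 6 < real L" using Y by simp
    then have L7: "7 \<le> L" unfolding of_nat_less_iff by simp
    \<comment> \<open>Chosen so that 2 pi \<epsilon> = 17/5 * pi / (L + 2), as in
      \<open>one_minus_cos_ratio\<close>; Y < 4 (L + 1) then gives \<epsilon> <= 34/5 / Y, as in
      \<open>affine_iteration_bound\<close>.\<close>
    define \<epsilon> where "\<epsilon> = 17 / 10 / (real L + 2)"
    have eps: "0 < \<epsilon>" "\<epsilon> \<le> 1 / 2" "\<epsilon> \<le> 34 / 5 / Y"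
      using L7 L(2) pos by (auto simp: \<epsilon>_def field_simps)
    obtain \<kappa> where \<kappa>: "\<kappa> 0 = 1" "\<And>h. \<kappa> (- h) = \<kappa> h" "\<And>h. \<bar>\<kappa> h\<bar> \<le> 1"
        "\<kappa> 1 = cos (pi / (real L + 2))"
        "\<And>y. 0 \<le> (\<Sum>h\<in>{- int L..int L}. \<kappa> h * cos (2 * pi * of_int h * y))"
      by (rule fejer_korovkin_kernel[of L]) blast
    interpret smoothing_kernel L \<kappa> by unfold_locales (use \<kappa> in auto)
    have tail: "1 - \<kappa> 1 \<le> 1 / 10 * (1 - cos (2 * pi * \<epsilon>))"
    proof -
      have "2 * pi * \<epsilon> = 17 / 5 * (pi / (real L + 2))" by (simp add: \<epsilon>_def field_simps)
      moreover have "pi / (real L + 2) \<le> pi / 9" using L7 by (intro divide_left_mono) auto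
      ultimately show ?thesis using one_minus_cos_ratio[of "pi / (real L + 2)"] \<kappa>(4) by simp
    qed
    have smooth: "\<bar>(\<Sum>x\<in>set_pmf P. pmf P x * (\<Prod>i\<in>UNIV. prim (v i - x $ i) - prim (u i - x $ i))) - (\<Prod>i\<in>UNIV. v i - u i)\<bar> \<le> 1 / Y"
      if "\<And>i. u i \<le> v i \<and> v i \<le> u i + 1" for u v
    proof -
      have "\<bar>(\<Sum>x\<in>set_pmf P. pmf P x * (\<Prod>i\<in>UNIV. prim (v i - x $ i) - prim (u i - x $ i))) - (\<Prod>i\<in>UNIV. v i - u i)\<bar>
        \<le> (\<Sum>h\<in>(UNIV \<rightarrow>\<^sub>E {- int L..int L}) - {\<lambda>_. 0}. cmod (fourier h P) / (pi * of_int (int_norm h)))"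
        unfolding fourier_def using that fin
        by (intro smoothed_discrepancy) (auto intro!: sum_pmf_eq_1)
      also have "\<dots> \<le> 1 / Y"
        using walk_exponential_sum[OF assms(1,2)] L(1) by (simp add: P_def Y_def d_def n_def)
      finally show ?thesis .
    qed
    have "\<bar>(\<Sum>x\<in>set_pmf P. pmf P x * (\<Prod>i\<in>UNIV. if i \<in> (UNIV :: 'd set) then of_int \<lceil>b $ i - x $ i\<rceil> - of_int \<lceil>a $ i - x $ i\<rceil>
            else prim (b $ i - x $ i) - prim (a $ i - x $ i))) - (\<Prod>i\<in>UNIV. b $ i - a $ i)\<bar>
        \<le> ((\<lambda>y. (y + 2 * \<epsilon>) / (1 - 2 * (1 / 10))) ^^ card (UNIV :: 'd set)) (1 / Y)"
    proof (rule coordinatewise_discrepancy[OF _ eps(1,2) tail _ fin _ smooth])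
      show "a $ i \<le> b $ i \<and> b $ i \<le> a $ i + 1" for i
        using box[OF ab, of i] by simp
    qed (use L7 in auto)
    also have "\<dots> \<le> (69 * (5 / 4) ^ CARD('d) - 68) / Y"
      by (intro affine_iteration_bound eps) simp
    also have "\<dots> \<le> 20 * (3/2) ^ CARD('d) / Y"
      using pos by (intro divide_right_mono numeric_bound) (auto simp: Suc_leI)
    finally have "\<bar>(\<Sum>x\<in>set_pmf P. pmf P x * (\<Prod>i\<in>UNIV. of_int \<lceil>b $ i - x $ i\<rceil> - of_int \<lceil>a $ i - x $ i\<rceil>))
        - (\<Prod>i\<in>UNIV. b $ i - a $ i)\<bar> \<le> 20 * (3/2) ^ CARD('d) / Y"
      by simp
    moreover have "measure_pmf.prob P (torus_box a b)
        = (\<Sum>x\<in>set_pmf P. pmf P x * (\<Prod>i\<in>UNIV. of_int \<lceil>b $ i - x $ i\<rceil> - of_int \<lceil>a $ i - x $ i\<rceil>))"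
      by (rule prob_torus_box[OF fin _ ab]) (unfold P_def, rule conv_power_in_unit_cube)
    ultimately show ?thesis by (simp only: haar_box_def)
  qed
  then have "discrepancy P \<le> 20 * (3/2) ^ CARD('d) / Y"
    unfolding discrepancy_def
    by (intro cSUP_least) (auto simp: is_box_params_def intro!: exI[of _ 0])
  then show ?thesis using rhs by (simp only: P_def n_def d_def)
qed

end
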